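(* Let $G$ be a connected graph of order $n\ge 4$. Then $rx_4(G)=3$ if and only if $G$ is one of the following graphs: (1) $G$ is a connected graph of order $4$; (2) $G$ is of order $5$ and $\overline{G}$ is a subgraph of $P_5$ or of $K_2\cup K_3$; (3) $G$ is of order $6$ and $\overline{G}$ is a subgraph of $C_6$ or of $2K_3$; (4) $G$ is of order $7$ and $\overline{G}$ is a subgraph of $C_6$, of $2K_2\cup K_3$, of $P_5\cup K_2$, or of $2K_3$; (5) $G$ is of order $8$ and $\overline{G}$ is a subgraph of $K_2\cup 2K_3$ or of $P_6\cup K_2$; (6) $G$ is of order $9$ and $\overline{G}$ is a subgraph of $3K_3$ or of $P_3\cup 3K_2$.
   Context: All graphs are simple and finite. For a connected graph $G$, an edge-coloring $c:E(G)\to\{1,\dots,q\}$ (adjacent edges may get the same color) is a $k$-rainbow coloring if for every set $S$ of $k$ vertices there is a tree in $G$ containing $S$ whose edges have pairwise distinct colors (a rainbow $S$-tree). The $k$-rainbow index $rx_k(G)$ is the minimum $q$ for which a $k$-rainbow coloring exists (defined for connected $G$ of order at least $k$). $\overline{G}$ is the complement of $G$. For a graph $F$ with at most $n$ vertices, "$\overline{G}$ is a subgraph of $F$" means $\overline{G}$ is isomorphic to a subgraph of the graph obtained from $F$ by adding $n-|V(F)|$ isolated vertices. $P_m$, $C_m$, $K_m$ denote the path, cycle and complete graph on $m$ vertices; $\cup$ is disjoint union and $tH$ is the disjoint union of $t$ copies of $H$. *)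

theory Defs
  imports Main
begin

text \<open>
  Finite simple graphs with unordered edges. The symmetric digraphs of \<open>Graph_Theory\<close> are not
  used because there the closed walk \<open>a, b, a\<close> along an edge counts as a cycle, so that its notion
  of tree is not the undirected one.
\<close>

record 'a sgraph =
  verts :: "'a set"
  edges :: "'a set set"

definition simple_graph :: "'a sgraph \<Rightarrow> bool" where
  "simple_graph G \<longleftrightarrow> finite (verts G) \<and>
     edges G \<subseteq> {{u, v} | u v. u \<in> verts G \<and> v \<in> verts G \<and> u \<noteq> v}"

definition order :: "'a sgraph \<Rightarrow> nat" where
  "order G = card (verts G)"

definition connected_graph :: "'a sgraph \<Rightarrow> bool" where
  "connected_graph G \<longleftrightarrow> verts G \<noteq> {} \<and>
     (\<forall>u \<in> verts G. \<forall>v \<in> verts G. (u, v) \<in> {(x, y). {x, y} \<in> edges G}\<^sup>*)"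

text \<open>The list holds the vertices of a cycle in cyclic order, without repeating the first one.\<close>

definition is_cycle :: "'a sgraph \<Rightarrow> 'a list \<Rightarrow> bool" where
  "is_cycle G xs \<longleftrightarrow> 3 \<le> length xs \<and> distinct xs \<and>
     (\<forall>i < length xs. {xs ! i, xs ! (Suc i mod length xs)} \<in> edges G)"

definition tree :: "'a sgraph \<Rightarrow> bool" where
  "tree T \<longleftrightarrow> simple_graph T \<and> connected_graph T \<and> (\<nexists>xs. is_cycle T xs)"

definition subgraph :: "'a sgraph \<Rightarrow> 'a sgraph \<Rightarrow> bool" where
  "subgraph H G \<longleftrightarrow> simple_graph H \<and> verts H \<subseteq> verts G \<and> edges H \<subseteq> edges G"

definition isomorphic :: "'a sgraph \<Rightarrow> 'b sgraph \<Rightarrow> bool" where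
  "isomorphic G H \<longleftrightarrow>
     (\<exists>f. bij_betw f (verts G) (verts H) \<and> edges H = (\<lambda>e. f ` e) ` edges G)"

definition complement :: "'a sgraph \<Rightarrow> 'a sgraph" where
  "complement G = \<lparr>verts = verts G,
     edges = {{u, v} | u v. u \<in> verts G \<and> v \<in> verts G \<and> u \<noteq> v \<and> {u, v} \<notin> edges G}\<rparr>"

definition rainbow_tree :: "'a sgraph \<Rightarrow> ('a set \<Rightarrow> nat) \<Rightarrow> 'a set \<Rightarrow> 'a sgraph \<Rightarrow> bool" where
  "rainbow_tree G c S T \<longleftrightarrow> tree T \<and> subgraph T G \<and> S \<subseteq> verts T \<and> inj_on c (edges T)"

definition rainbow_coloring :: "nat \<Rightarrow> 'a sgraph \<Rightarrow> nat \<Rightarrow> ('a set \<Rightarrow> nat) \<Rightarrow> bool" where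
  "rainbow_coloring k G q c \<longleftrightarrow> c ` edges G \<subseteq> {1..q} \<and>
     (\<forall>S. S \<subseteq> verts G \<and> card S = k \<longrightarrow> (\<exists>T. rainbow_tree G c S T))"

text \<open>
  For connected \<open>G\<close> some coloring always exists (give all edges different colors), so the
  minimum exists; for disconnected \<open>G\<close> the value carries no meaning.
\<close>

definition rainbow_index :: "nat \<Rightarrow> 'a sgraph \<Rightarrow> nat" where
  "rainbow_index k G = (LEAST q. \<exists>c. rainbow_coloring k G q c)"

definition path_graph :: "nat \<Rightarrow> nat sgraph" where
  "path_graph m = \<lparr>verts = {..<m}, edges = {{i, Suc i} | i. Suc i < m}\<rparr>"

text \<open>A cycle only for \<open>m \<ge> 3\<close>.\<close>

definition cycle_graph :: "nat \<Rightarrow> nat sgraph" where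
  "cycle_graph m = \<lparr>verts = {..<m}, edges = {{i, Suc i mod m} | i. i < m}\<rparr>"

definition complete_graph :: "nat \<Rightarrow> nat sgraph" where
  "complete_graph m = \<lparr>verts = {..<m}, edges = {{i, j} | i j. i < m \<and> j < m \<and> i \<noteq> j}\<rparr>"

definition edgeless_graph :: "nat \<Rightarrow> nat sgraph" where
  "edgeless_graph m = \<lparr>verts = {..<m}, edges = {}\<rparr>"

definition disjoint_union :: "'a sgraph \<Rightarrow> 'b sgraph \<Rightarrow> ('a + 'b) sgraph"  (infixr \<open>\<uplus>\<close> 65) where
  "G \<uplus> H = \<lparr>verts = verts G <+> verts H,
     edges = (\<lambda>e. Inl ` e) ` edges G \<union> (\<lambda>e. Inr ` e) ` edges H\<rparr>"

definition copies :: "nat \<Rightarrow> 'a sgraph \<Rightarrow> (nat \<times> 'a) sgraph" where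
  "copies t H = \<lparr>verts = {..<t} \<times> verts H, edges = (\<Union>i<t. (\<lambda>e. Pair i ` e) ` edges H)\<rparr>"

text \<open>
  Subgraph up to isomorphism, after padding \<open>F\<close> with isolated vertices to the order of \<open>H\<close>;
  meant for \<open>order F \<le> order H\<close>.
\<close>

definition is_subgraph_of :: "'a sgraph \<Rightarrow> 'b sgraph \<Rightarrow> bool" where
  "is_subgraph_of H F \<longleftrightarrow>
     (\<exists>H'. subgraph H' (F \<uplus> edgeless_graph (order H - order F)) \<and> isomorphic H H')"

end

(* A tree on four given vertices with three differently colored edges spans exactly these vertices.
   So a coloring with three colors is 4-rainbow only if every 4-set of vertices meets every color and
   induces a subgraph without isolated vertices. Hence the complement H has maximum degree at most
   two, contains no C4 and no C5, no P4 + P3 (the order is then at least 7), no C6 if the order is at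
   least 8, no P4 and no K3 + 3K2 if it is at least 9, and the order is at most 9. Apart from the
   degree bound these are finite propositional statements, refuted by a SAT solver with proof replay
   after the color symmetry has been broken by hand.

   A graph H of maximum degree two is a disjoint union of paths and cycles, and what survives the
   exclusions is a finite list of partitions of the order; each of them refines the partition into
   component orders of one of the graphs in the theorem. Conversely, four explicit colorings (for
   the complements of 3K3, P3 + 3K2, P6 + K2 and C6 + K1) suffice, because being 4-rainbow is
   inherited by induced subgraphs and by adding edges. *)

theory Submission
  imports Defs "HOL-Library.Multiset"
begin

section \<open>Trees and rainbow colorings\<close>

text \<open>Both directions are reduced to finite tests on positions 0, ..., n - 1. The target
  graphs live on numbers, sums and products; \<open>numbered\<close> turns their edges into lists of
  pairs of positions, and \<open>fits\<close> says that the vertices of the complement can be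
  enumerated so that its edges lie among these pairs. A component is stored only as a list along a
  Hamiltonian path. Whether it is closed to a cycle is judged by its order alone: if that order
  admits a cycle, the component is treated as one. This loses something only at order 9, where the
  orders 3, 2, 2, 2 are allowed with P3 and forbidden with K3; hence two packing tests there. The
  order bound is not refuted outright. On ten vertices a local argument first fixes the colors of
  fifteen pairs around one vertex, and only then is the rest left to the solver.\<close>

lemma edge_in_simple_graph:
  assumes "simple_graph G" "{x, y} \<in> edges G"
  shows "x \<in> verts G" "y \<in> verts G" "x \<noteq> y"
  using assms unfolding simple_graph_def by (auto simp: doubleton_eq_iff)

lemma edge_of_simple_graph:
  assumes "simple_graph G" "e \<in> edges G"
  obtains x y where "e = {x, y}" "x \<in> verts G" "y \<in> verts G" "x \<noteq> y"
  using assms unfolding simple_graph_def by blast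

lemma finite_edges:
  assumes "simple_graph G"
  shows "finite (edges G)"
proof (rule finite_subset)
  show "edges G \<subseteq> Pow (verts G)"
    using assms by (auto elim: edge_of_simple_graph)
  show "finite (Pow (verts G))"
    using assms by (simp add: simple_graph_def)
qed

lemma tree_singleton: "tree \<lparr>verts = {v}, edges = {}\<rparr>"
  unfolding tree_def simple_graph_def connected_graph_def is_cycle_def
  by (auto intro: exI[of _ 0])

lemma connected_graph_add_leaf:
  assumes "connected_graph T" "u \<in> verts T"
  shows "connected_graph \<lparr>verts = insert v (verts T), edges = insert {u, v} (edges T)\<rparr>"
proof -
  let ?R = "{(x, y). {x, y} \<in> edges T}" and ?R' = "{(x, y). {x, y} \<in> insert {u, v} (edges T)}"
  have "?R \<subseteq> ?R'" by auto
  then have sub: "?R\<^sup>* \<subseteq> ?R'\<^sup>*" by (rule rtrancl_mono)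
  have old: "(x, y) \<in> ?R'\<^sup>*" if "x \<in> verts T" "y \<in> verts T" for x y
    using that assms(1) sub unfolding connected_graph_def by blast
  have uv: "(u, v) \<in> ?R'" "(v, u) \<in> ?R'" by (auto simp: insert_commute)
  have "(x, y) \<in> ?R'\<^sup>*" if "x \<in> insert v (verts T)" "y \<in> insert v (verts T)" for x y
  proof -
    have "(x, u) \<in> ?R'\<^sup>*" using that(1) old assms(2) uv by blast
    moreover have "(u, y) \<in> ?R'\<^sup>*" using that(2) old assms(2) uv by blast
    ultimately show ?thesis by (rule rtrancl_trans)
  qed
  then show ?thesis unfolding connected_graph_def by simp
qed

text \<open>A cycle through the new vertex \<open>v\<close> would have \<open>u\<close> both before
  and after \<open>v\<close>, because \<open>{u, v}\<close> is the only edge at \<open>v\<close>; on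
  a cycle of length at least 3 these are different positions.\<close>

lemma tree_add_leaf:
  assumes "tree T" "u \<in> verts T" "v \<notin> verts T"
  shows "tree \<lparr>verts = insert v (verts T), edges = insert {u, v} (edges T)\<rparr>" (is "tree ?T'")
proof -
  have T: "simple_graph T" "connected_graph T" "\<nexists>xs. is_cycle T xs"
    using assms(1) by (auto simp: tree_def)
  have "u \<noteq> v" using assms by auto
  then have "simple_graph ?T'"
    using T(1) assms(2) unfolding simple_graph_def by auto blast
  moreover have "\<not> is_cycle ?T' xs" for xs
  proof
    assume cyc: "is_cycle ?T' xs"
    let ?m = "length xs"
    have m: "3 \<le> ?m" "distinct xs"
      and e: "\<And>i. i < ?m \<Longrightarrow> {xs ! i, xs ! (Suc i mod ?m)} \<in> insert {u, v} (edges T)"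
      using cyc by (auto simp: is_cycle_def)
    show False
    proof (cases "v \<in> set xs")
      case False
      have "{xs ! i, xs ! (Suc i mod ?m)} \<in> edges T" if "i < ?m" for i
      proof -
        have "Suc i mod ?m < ?m" using m(1) by (intro mod_less_divisor) auto
        with False that have "v \<noteq> xs ! i" "v \<noteq> xs ! (Suc i mod ?m)" by auto
        then show ?thesis using e[OF that] by (auto simp: doubleton_eq_iff)
      qed
      then show False using T(3) m by (auto simp: is_cycle_def)
    next
      case True
      then obtain i where i: "i < ?m" "xs ! i = v" by (auto simp: in_set_conv_nth)
      \<comment> \<open>The cyclic predecessor of \<open>i\<close>, also when
        \<open>i = 0\<close>.\<close>
      define k where "k = (if i = 0 then ?m - 1 else i - 1)"
      have k: "k < ?m" "Suc k mod ?m = i" using i m(1) by (auto simp: k_def)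
      let ?j = "Suc i mod ?m"
      have j: "?j < ?m" using m(1) by (intro mod_less_divisor) auto
      have v: "\<And>x. {v, x} \<notin> edges T" "\<And>x. {x, v} \<notin> edges T"
        using T(1) assms(3) edge_in_simple_graph by metis+
      have "xs ! ?j = u" using e[OF i(1)] i(2) v by (auto simp: doubleton_eq_iff)
      moreover have "xs ! k = u" using e[OF k(1)] k(2) i(2) v by (auto simp: doubleton_eq_iff)
      ultimately have "?j = k" using nth_eq_iff_index_eq[OF m(2) j k(1)] by simp
      then show False using i(1) m(1) by (auto simp: k_def mod_Suc split: if_splits)
    qed
  qed
  ultimately show ?thesis
    using connected_graph_add_leaf[OF T(2) assms(2)] unfolding tree_def by blast
qed

lemma connected_graph_leaving_edge:
  assumes "simple_graph G" "connected_graph G" "W \<subset> verts G" "w \<in> W"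
  obtains u v where "u \<in> W" "v \<in> verts G - W" "{u, v} \<in> edges G"
proof (rule ccontr)
  assume contra: "\<not> thesis"
  obtain z where z: "z \<in> verts G" "z \<notin> W" using assms(3) by blast
  have "(w, z) \<in> {(x, y). {x, y} \<in> edges G}\<^sup>*"
    using assms z unfolding connected_graph_def by blast
  then have "z \<in> W"
  proof induction
    case (step x y)
    then have "y \<in> verts G" using edge_in_simple_graph[OF assms(1)] by blast
    then show ?case using step that contra by blast
  qed (rule assms(4))
  with z show False by simp
qed

text \<open>While the tree misses a vertex, some edge leaves it, and that edge adds a leaf. Counting
  the edges along the way makes this serve as the spanning tree theorem and as the source of the
  edge count.\<close>

lemma subtree_of_connected_graph:
  assumes "simple_graph G" "connected_graph G" "k < card (verts G)"
  shows "\<exists>T. tree T \<and> subgraph T G \<and> card (verts T) = Suc k \<and> card (edges T) = k"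
  using assms(3)
proof (induction k)
  case 0
  obtain v where "v \<in> verts G" using assms(2) by (auto simp: connected_graph_def)
  then show ?case
    using tree_singleton[of v]
    by (intro exI[of _ "\<lparr>verts = {v}, edges = {}\<rparr>"]) (auto simp: subgraph_def tree_def)
next
  case (Suc k)
  then obtain T where T: "tree T" "subgraph T G" "card (verts T) = Suc k" "card (edges T) = k"
    by auto
  have sT: "simple_graph T" "verts T \<subseteq> verts G" using T(2) by (auto simp: subgraph_def)
  then have "verts T \<subset> verts G" using T(3) Suc.prems by auto
  moreover obtain w where "w \<in> verts T" using T(3) by fastforce
  ultimately obtain u v where uv: "u \<in> verts T" "v \<in> verts G - verts T" "{u, v} \<in> edges G"
    using connected_graph_leaving_edge[OF assms(1,2)] by metis
  let ?T' = "\<lparr>verts = insert v (verts T), edges = insert {u, v} (edges T)\<rparr>"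
  have tree: "tree ?T'" using tree_add_leaf[OF T(1)] uv by blast
  moreover have "subgraph ?T' G" using tree T(2) uv by (auto simp: subgraph_def tree_def)
  moreover have "card (verts ?T') = Suc (Suc k)"
    using T(3) uv sT by (simp add: simple_graph_def)
  moreover have "{u, v} \<notin> edges T" using edge_in_simple_graph[OF sT(1)] uv(2) by blast
  then have "card (edges ?T') = Suc k" using T(4) finite_edges[OF sT(1)] by simp
  ultimately show ?case by blast
qed

lemma card_verts_le_edges:
  assumes "simple_graph G" "connected_graph G"
  shows "card (verts G) \<le> Suc (card (edges G))"
proof (cases "card (verts G)")
  case (Suc k)
  then obtain T where "subgraph T G" "card (edges T) = k"
    using subtree_of_connected_graph[OF assms, of k] by auto
  then have "k \<le> card (edges G)"
    using card_mono[OF finite_edges[OF assms(1)]] by (auto simp: subgraph_def)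
  then show ?thesis using Suc by simp
qed simp

section \<open>Rainbow trees with few colors\<close>

lemma rainbow_tree_card_le:
  assumes "rainbow_tree G c S T" "c ` edges G \<subseteq> {1..q}"
  shows "card (edges T) \<le> q" "card (verts T) \<le> Suc q"
proof -
  have T: "tree T" "edges T \<subseteq> edges G" "inj_on c (edges T)"
    using assms(1) by (auto simp: rainbow_tree_def subgraph_def)
  have "card (edges T) = card (c ` edges T)" using T(3) by (simp add: card_image)
  also have "\<dots> \<le> card {1..q}" using assms(2) T(2) by (intro card_mono) auto
  finally show "card (edges T) \<le> q" by simp
  with card_verts_le_edges[of T] T(1) show "card (verts T) \<le> Suc q" by (simp add: tree_def)
qed

text \<open>Three colors allow at most three edges and hence at most four vertices, and
  \<open>S\<close> accounts for all four. So all these bounds are equalities.\<close>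

lemma rainbow_tree_spans:
  assumes "rainbow_tree G c S T" "c ` edges G \<subseteq> {1..3}" "card S = 4"
  shows "verts T = S" "c ` edges T = {1..3}"
proof -
  have T: "tree T" "edges T \<subseteq> edges G" "inj_on c (edges T)" "S \<subseteq> verts T"
    using assms(1) by (auto simp: rainbow_tree_def subgraph_def)
  have fin: "finite (verts T)" using T(1) by (simp add: tree_def simple_graph_def)
  have le: "card (edges T) \<le> 3" "card (verts T) \<le> 4"
    using rainbow_tree_card_le[OF assms(1,2)] by auto
  then show "verts T = S" using card_subset_eq[OF fin T(4)] card_mono[OF fin T(4)] assms(3) by simp
  then have "card (edges T) = 3"
    using le card_verts_le_edges[of T] T(1) assms(3) by (simp add: tree_def)
  then have "card (c ` edges T) = card {1..3::nat}" using T(3) by (simp add: card_image)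
  then show "c ` edges T = {1..3}"
    using assms(2) T(2) by (intro card_subset_eq) auto
qed

text \<open>With all edges colored differently one spanning tree serves every \<open>S\<close>. This
  makes the \<open>LEAST\<close> in \<open>rainbow_index\<close> an attained minimum.\<close>

lemma rainbow_coloring_exists:
  assumes "simple_graph G" "connected_graph G"
  shows "\<exists>q c. rainbow_coloring k G q c"
proof -
  obtain T where T: "tree T" "subgraph T G" "card (verts T) = card (verts G)"
    using subtree_of_connected_graph[OF assms, of "card (verts G) - 1"] assms
    by (fastforce simp: simple_graph_def connected_graph_def card_gt_0_iff)
  then have "verts T = verts G"
    using assms(1) card_subset_eq[of "verts G" "verts T"] by (simp add: simple_graph_def subgraph_def)
  obtain c where "bij_betw c (edges G) {1..card (edges G)}"
    using finite_edges[OF assms(1)] by (rule ex_bij_betw_nat_finite_1[THEN exE, OF _ that[OF bij_betw_inv_into]])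
  then have c: "inj_on c (edges G)" "c ` edges G \<subseteq> {1..card (edges G)}"
    by (auto simp: bij_betw_def)
  have "rainbow_tree G c S T" if "S \<subseteq> verts G" for S
    using T \<open>verts T = verts G\<close> c(1) that
    by (auto simp: rainbow_tree_def subgraph_def intro: inj_on_subset)
  then have "rainbow_coloring k G (card (edges G)) c"
    using c(2) unfolding rainbow_coloring_def by blast
  then show ?thesis by blast
qed

text \<open>Fewer than three colors never suffice, since a tree on at least four vertices has at
  least three edges. So the index is 3 as soon as three colors are enough.\<close>

lemma rainbow_index_4_eq_3_iff:
  assumes "simple_graph G" "connected_graph G" "4 \<le> order G"
  shows "rainbow_index 4 G = 3 \<longleftrightarrow> (\<exists>c. rainbow_coloring 4 G 3 c)"
proof -
  have lower: "3 \<le> q" if "rainbow_coloring 4 G q c" for q c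
  proof -
    obtain S where S: "S \<subseteq> verts G" "card S = 4"
      using assms(3) obtain_subset_with_card_n unfolding order_def by metis
    then have "\<exists>T. rainbow_tree G c S T"
      using that unfolding rainbow_coloring_def by blast
    then obtain T where T: "rainbow_tree G c S T" ..
    then have "4 \<le> card (verts T)"
      using S(2) card_mono[of "verts T" S]
      by (simp add: rainbow_tree_def tree_def simple_graph_def)
    with rainbow_tree_card_le(2)[OF T, of q] that show "3 \<le> q"
      by (simp add: rainbow_coloring_def)
  qed
  show ?thesis
  proof
    assume "rainbow_index 4 G = 3"
    with rainbow_coloring_exists[OF assms(1,2), of 4] show "\<exists>c. rainbow_coloring 4 G 3 c"
      unfolding rainbow_index_def using LeastI_ex[of "\<lambda>q. \<exists>c. rainbow_coloring 4 G q c"] by simp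
  next
    assume "\<exists>c. rainbow_coloring 4 G 3 c"
    then show "rainbow_index 4 G = 3"
      unfolding rainbow_index_def using lower by (intro Least_equality) blast+
  qed
qed

text \<open>The three edges of a spanning tree receive the three colors, and this tree contains
  every \<open>S\<close>.\<close>

lemma rainbow_coloring_spanning:
  assumes "simple_graph G" "connected_graph G" "order G = 4"
  shows "\<exists>c. rainbow_coloring 4 G 3 c"
proof -
  have V: "finite (verts G)" "card (verts G) = 4"
    using assms by (auto simp: order_def simple_graph_def)
  obtain T where T: "tree T" "subgraph T G" "card (verts T) = 4" "card (edges T) = 3"
    using subtree_of_connected_graph[OF assms(1,2), of 3] V(2) by auto
  then have verts: "verts T = verts G"
    using V card_subset_eq[OF V(1)] by (simp add: subgraph_def)
  have "finite (edges T)" using T(1) finite_edges by (auto simp: tree_def)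
  then obtain b where b: "bij_betw b (edges T) {1..3::nat}"
    using T(4) finite_same_card_bij[of "edges T" "{1..3::nat}"] by auto
  \<comment> \<open>The value 1 outside the tree merely keeps the remaining edges in the range of
    colors.\<close>
  define c where "c e = (if e \<in> edges T then b e else 1)" for e
  have "c e \<in> {1..3}" for e
    using b by (auto simp: c_def bij_betw_def)
  moreover have "inj_on c (edges T)" using b by (auto simp: c_def bij_betw_def inj_on_def)
  then have "rainbow_tree G c S T" if "S \<subseteq> verts G" for S
    using T that verts by (auto simp: rainbow_tree_def)
  ultimately have "rainbow_coloring 4 G 3 c" unfolding rainbow_coloring_def by blast
  then show ?thesis by blast
qed

section \<open>Colorings in which every quadruple meets every color\<close>

text \<open>Unfolds a bounded quantifier into a conjunction whose indices remain numerals, so that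
  equal atoms are syntactically equal when the solver receives them.\<close>

lemma all_less_numeral: "(\<forall>i<numeral k. P (i::nat)) \<longleftrightarrow> P (pred_numeral k) \<and> (\<forall>i<pred_numeral k. P i)"
  by (auto simp: numeral_eq_Suc less_Suc_eq)

lemma all_less_one: "(\<forall>i<(1::nat). P i) \<longleftrightarrow> P 0"
  by auto

lemma all_less_zero: "(\<forall>i<(0::nat). P i) \<longleftrightarrow> True"
  by auto

lemmas bounded_all_simps = all_less_numeral all_less_one all_less_zero
  pred_numeral_simps Num.BitM.simps numeral_One simp_thms

text \<open>The propositional skeleton of a coloring: one atom per color and pair of positions, with
  the smaller position always first, so that symmetry is built in. A pair with no true atom is a
  missing edge.\<close>

definition meets_quads ::
    "nat \<Rightarrow> (nat \<Rightarrow> nat \<Rightarrow> bool) \<Rightarrow> (nat \<Rightarrow> nat \<Rightarrow> bool) \<Rightarrow> (nat \<Rightarrow> nat \<Rightarrow> bool) \<Rightarrow> bool" where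
  "meets_quads n A B C \<longleftrightarrow>
     (\<forall>l<n. \<forall>k<l. \<forall>j<k. \<forall>i<j.
       (A i j \<or> A i k \<or> A i l \<or> A j k \<or> A j l \<or> A k l) \<and>
       (B i j \<or> B i k \<or> B i l \<or> B j k \<or> B j l \<or> B k l) \<and>
       (C i j \<or> C i k \<or> C i l \<or> C j k \<or> C j l \<or> C k l)) \<and>
     (\<forall>j<n. \<forall>i<j. \<not> (A i j \<and> B i j) \<and> \<not> (A i j \<and> C i j) \<and> \<not> (B i j \<and> C i j))"

text \<open>Only the two diagonals remain for three colors.\<close>

lemma meets_quads_C4:
  assumes "meets_quads 4 A B C"
    and "\<forall>(i, j) \<in> set [(0, 1), (1, 2), (2, 3), (0, 3)].
      \<not> A i j \<and> \<not> B i j \<and> \<not> C i j"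
  shows False
  using assms unfolding meets_quads_def list.set ball_simps split
  by (simp only: bounded_all_simps, sat)

text \<open>The remaining pairs form a pentagram, again a cycle of length 5. Dropping a vertex
  leaves three consecutive edges of it, which must carry three different colors; the colors would
  have period 3 around a cycle of length 5.\<close>

lemma meets_quads_C5:
  assumes "meets_quads 5 A B C"
    and "\<forall>(i, j) \<in> set [(0, 1), (1, 2), (2, 3), (3, 4), (0, 4)].
      \<not> A i j \<and> \<not> B i j \<and> \<not> C i j"
  shows False
  using assms unfolding meets_quads_def list.set ball_simps split
  by (simp only: bounded_all_simps, sat)

text \<open>A quadruple on an omitted path \<open>0, 1, 2, 3\<close> has only three pairs left, so these carry all
  three colors; fixing which one carries which breaks the color symmetry. The same holds for an
  omitted triangle together with a fourth vertex.\<close>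

lemma meets_quads_P4_P3:
  assumes "meets_quads 7 A B C"
    and "A 0 2" "B 0 3" "C 1 3"
    and "\<forall>(i, j) \<in> set [(0, 1), (1, 2), (2, 3), (4, 5), (5, 6)].
      \<not> A i j \<and> \<not> B i j \<and> \<not> C i j"
  shows False
  using assms unfolding meets_quads_def list.set ball_simps split
  by (simp only: bounded_all_simps, sat)

text \<open>The eighth vertex is essential: \<open>table_C6\<close> colors seven vertices with a
  six-cycle omitted.\<close>

lemma meets_quads_C6:
  assumes "meets_quads 8 A B C"
    and "A 0 2" "B 0 3" "C 1 3"
    and "\<forall>(i, j) \<in> set [(0, 1), (1, 2), (2, 3), (3, 4), (4, 5), (0, 5)].
      \<not> A i j \<and> \<not> B i j \<and> \<not> C i j"
  shows False
  using assms unfolding meets_quads_def list.set ball_simps split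
  by (simp only: bounded_all_simps, sat)

text \<open>The ninth vertex is essential: \<open>table_P6_K2\<close> omits even a path on six
  vertices among eight.\<close>

lemma meets_quads_P4:
  assumes "meets_quads 9 A B C"
    and "A 0 2" "B 0 3" "C 1 3"
    and "\<forall>(i, j) \<in> set [(0, 1), (1, 2), (2, 3)].
      \<not> A i j \<and> \<not> B i j \<and> \<not> C i j"
  shows False
  using assms unfolding meets_quads_def list.set ball_simps split
  by (simp only: bounded_all_simps, sat)

text \<open>The omitted graph is that of \<open>table_P3_K2_K2_K2\<close> with its path closed to a
  triangle. It does not lie in 3K3 either, as three disjoint edges do not fit into two
  triangles.\<close>

lemma meets_quads_K3_3K2:
  assumes "meets_quads 9 A B C"
    and "A 0 3" "B 1 3" "C 2 3"
    and "\<forall>(i, j) \<in> set [(0, 1), (1, 2), (0, 2), (3, 4), (5, 6), (7, 8)].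
      \<not> A i j \<and> \<not> B i j \<and> \<not> C i j"
  shows False
  using assms unfolding meets_quads_def list.set ball_simps split
  by (simp only: bounded_all_simps, sat)

text \<open>Counting alone leaves room: by Turan's bounds the three colors need at least 9 + 5 + 5 =
  19 of the 21 pairs. The atom \<open>B 0 1\<close> breaks the symmetry, since some pair of the
  second color can be numbered first.\<close>

lemma meets_quads_7:
  assumes "meets_quads 7 A B C"
    and "\<forall>k<7. \<forall>j<k. \<forall>i<j. A i j \<or> A i k \<or> A j k"
    and "B 0 1"
  shows False
  using assms unfolding meets_quads_def list.set ball_simps split
  by (simp only: bounded_all_simps, sat)

text \<open>Position 0 is a vertex with three neighbors in each color, at 1 to 3, 4 to 6 and 7 to 9.
  The last six atoms place the two other colors inside each of these neighborhoods.\<close>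

lemma meets_quads_10:
  assumes "meets_quads 10 A B C"
    and "A 0 1" "A 0 2" "A 0 3" "B 0 4" "B 0 5" "B 0 6" "C 0 7" "C 0 8" "C 0 9" "B 1 2" "C 1 3" "A 4 5" "C 4 6" "A 7 8" "B 7 9"
  shows False
  using assms unfolding meets_quads_def list.set ball_simps split
  by (simp only: bounded_all_simps, sat)

section \<open>Forbidden subgraphs of the complement\<close>

lemma extend_distinct_list:
  assumes "distinct xs" "set xs \<subseteq> W" "finite W" "length xs \<le> m" "m \<le> card W"
  shows "\<exists>ys. distinct (xs @ ys) \<and> set (xs @ ys) \<subseteq> W \<and> length (xs @ ys) = m"
proof -
  have "m - length xs \<le> card (W - set xs)"
    using card_Diff_subset[OF finite_set assms(2)] distinct_card[OF assms(1)] assms(5) by simp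
  then obtain Y where Y: "Y \<subseteq> W - set xs" "card Y = m - length xs" "finite Y"
    using assms(3) by (metis finite_Diff finite_subset obtain_subset_with_card_n)
  obtain ys where "distinct ys" "set ys = Y" using finite_distinct_list[OF Y(3)] by blast
  then show ?thesis using Y assms distinct_card[of ys] by (intro exI[of _ ys]) auto
qed

lemma card_eq_4_distinct: "card {a, b, c, d} = 4 \<longleftrightarrow> distinct [a, b, c, d]"
  by (auto simp: card_insert_if)

lemma three_of_three:
  assumes "{p, q, r} = {1, 2, 3::nat}"
  shows "p \<noteq> q" "p \<noteq> r" "q \<noteq> r" "p \<in> {1..3}" "q \<in> {1..3}" "r \<in> {1..3}"
proof -
  have "card {p, q, r} = 3" using assms by simp
  then show "p \<noteq> q" "p \<noteq> r" "q \<noteq> r" by (auto simp: card_insert_if split: if_splits)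
  have "{p, q, r} \<subseteq> {1..3}" unfolding assms by simp
  then show "p \<in> {1..3}" "q \<in> {1..3}" "r \<in> {1..3}" by simp_all
qed

section \<open>What a rainbow coloring forces on quadruples\<close>

locale rainbow_colored =
  fixes G :: "'a sgraph" and c :: "'a set \<Rightarrow> nat"
  assumes simple: "simple_graph G" and rainbow: "rainbow_coloring 4 G 3 c"
begin

definition col :: "nat \<Rightarrow> 'a \<Rightarrow> 'a \<Rightarrow> bool" where
  "col q u v \<longleftrightarrow> {u, v} \<in> edges G \<and> c {u, v} = q"

definition omits :: "'a list \<Rightarrow> (nat \<times> nat) list \<Rightarrow> bool" where
  "omits vs ps \<longleftrightarrow> (\<forall>(i, j) \<in> set ps. {vs ! i, vs ! j} \<notin> edges G)"

lemma col_sym: "col q u v \<longleftrightarrow> col q v u"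
  by (simp add: col_def insert_commute)

lemma finite_verts: "finite (verts G)"
  using simple by (simp add: simple_graph_def)

lemma obtain_tree:
  assumes "S \<subseteq> verts G" "card S = 4"
  obtains T where "tree T" "edges T \<subseteq> edges G" "verts T = S" "c ` edges T = {1..3}"
proof -
  have c: "c ` edges G \<subseteq> {1..3}" using rainbow by (simp add: rainbow_coloring_def)
  have "\<exists>T. rainbow_tree G c S T" using assms rainbow by (simp add: rainbow_coloring_def)
  then obtain T where T: "rainbow_tree G c S T" ..
  show thesis
  proof (rule that)
    show "tree T" "edges T \<subseteq> edges G"
      using T by (simp_all add: rainbow_tree_def subgraph_def)
  qed (use rainbow_tree_spans[OF T c assms(2)] in simp_all)
qed

lemma color_in_quad:
  assumes "S \<subseteq> verts G" "card S = 4" "q \<in> {1..3}"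
  shows "\<exists>u\<in>S. \<exists>v\<in>S. u \<noteq> v \<and> col q u v"
proof -
  obtain T where T: "tree T" "edges T \<subseteq> edges G" "verts T = S" "c ` edges T = {1..3}"
    by (rule obtain_tree[OF assms(1,2)])
  have "q \<in> c ` edges T" using T(4) assms(3) by simp
  then obtain e where e: "e \<in> edges T" "c e = q" by auto
  have "simple_graph T" using T(1) by (simp add: tree_def)
  then obtain u v where "e = {u, v}" "u \<in> verts T" "v \<in> verts T" "u \<noteq> v"
    using e(1) by (rule edge_of_simple_graph)
  then show ?thesis using e T by (auto simp: col_def)
qed

lemma neighbor_in_quad:
  assumes "S \<subseteq> verts G" "card S = 4" "v \<in> S"
  shows "\<exists>u\<in>S. {v, u} \<in> edges G"
proof -
  obtain T where T: "tree T" "edges T \<subseteq> edges G" "verts T = S" "c ` edges T = {1..3}"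
    by (rule obtain_tree[OF assms(1,2)])
  have sT: "simple_graph T" "connected_graph T" using T(1) by (auto simp: tree_def)
  have "verts T \<noteq> {v}" using T(3) assms(2) by auto
  then have "{v} \<subset> verts T" using T(3) assms(3) by auto
  then obtain w u where "w \<in> {v}" "u \<in> verts T - {v}" "{w, u} \<in> edges T"
    by (rule connected_graph_leaving_edge[OF sT]) simp
  then show ?thesis using T(2,3) by auto
qed

lemma color_in_distinct_quad:
  assumes "distinct [v, w, x, y]" "{v, w, x, y} \<subseteq> verts G" "q \<in> {1..3}"
  shows "col q v w \<or> col q v x \<or> col q v y \<or> col q w x \<or> col q w y \<or> col q x y"
proof -
  have "card {v, w, x, y} = 4" using assms(1) by (simp only: card_eq_4_distinct)
  with color_in_quad[OF assms(2) _ assms(3)] show ?thesis by (auto simp: col_sym)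
qed

lemma meets_quads_col:
  assumes "distinct vs" "set vs \<subseteq> verts G" "length vs = n" "{p, q, r} = {1, 2, 3}"
  shows "meets_quads n (\<lambda>i j. col p (vs ! i) (vs ! j)) (\<lambda>i j. col q (vs ! i) (vs ! j))
    (\<lambda>i j. col r (vs ! i) (vs ! j))"
proof -
  have "col t (vs ! i) (vs ! j) \<or> col t (vs ! i) (vs ! k) \<or> col t (vs ! i) (vs ! l)
      \<or> col t (vs ! j) (vs ! k) \<or> col t (vs ! j) (vs ! l) \<or> col t (vs ! k) (vs ! l)"
    if "l < n" "k < l" "j < k" "i < j" "t \<in> {1..3}" for i j k l t
  proof (rule color_in_distinct_quad)
    show "distinct [vs ! i, vs ! j, vs ! k, vs ! l]"
      using that(1-4) assms(1,3) by (simp add: nth_eq_iff_index_eq)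
    have "vs ! i \<in> set vs" "vs ! j \<in> set vs" "vs ! k \<in> set vs" "vs ! l \<in> set vs"
      using that(1-4) assms(3) by simp_all
    then show "{vs ! i, vs ! j, vs ! k, vs ! l} \<subseteq> verts G" using assms(2) by blast
  qed (rule that(5))
  moreover have "\<not> (col s u v \<and> col t u v)" if "s \<noteq> t" for s t u v
    using that by (auto simp: col_def)
  ultimately show ?thesis
    using three_of_three[OF assms(4)] by (simp add: meets_quads_def)
qed

lemma omits_col:
  assumes "omits vs ps"
  shows "\<forall>(i, j) \<in> set ps. \<not> col p (vs ! i) (vs ! j) \<and> \<not> col q (vs ! i) (vs ! j) \<and> \<not> col r (vs ! i) (vs ! j)"
  using assms by (auto simp: omits_def col_def)

text \<open>Connectivity enters here: the triangle on \<open>x\<close>, \<open>y\<close>,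
  \<open>z\<close> could well carry all three colors, but \<open>v\<close> would be isolated in its
  quadruple.\<close>

lemma no_omitted_star:
  assumes "distinct [v, x, y, z]" "{v, x, y, z} \<subseteq> verts G"
    "{v, x} \<notin> edges G" "{v, y} \<notin> edges G" "{v, z} \<notin> edges G"
  shows False
proof -
  have "card {v, x, y, z} = 4" using assms(1) by (simp only: card_eq_4_distinct)
  then have "\<exists>u\<in>{v, x, y, z}. {v, u} \<in> edges G"
    by (intro neighbor_in_quad[OF assms(2)]) simp_all
  then show False using assms(3-5) edge_in_simple_graph(3)[OF simple, of v v] by auto
qed

lemma no_omitted_C4:
  assumes "distinct vs" "set vs \<subseteq> verts G" "length vs = 4" "omits vs [(0, 1), (1, 2), (2, 3), (0, 3)]"
  shows False
  using meets_quads_C4[OF meets_quads_col[OF assms(1-3) refl] omits_col[OF assms(4)]] .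

lemma no_omitted_C5:
  assumes "distinct vs" "set vs \<subseteq> verts G" "length vs = 5"
    "omits vs [(0, 1), (1, 2), (2, 3), (3, 4), (0, 4)]"
  shows False
  using meets_quads_C5[OF meets_quads_col[OF assms(1-3) refl] omits_col[OF assms(4)]] .

text \<open>Pigeonhole: three values of \<open>c\<close> cover three colors, so each pair carries
  exactly one. A pair that is not an edge has some arbitrary value under \<open>c\<close>, but then
  its color would have to come from another pair.\<close>

lemma colors_of_three_pairs:
  assumes "\<And>t. t \<in> {1..3} \<Longrightarrow> col t a b \<or> col t d e \<or> col t f g"
  obtains p q r where "{p, q, r} = {1, 2, 3::nat}" "col p a b" "col q d e" "col r f g"
proof -
  define p where "p = c {a, b}"
  define q where "q = c {d, e}"
  define r where "r = c {f, g}"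
  have cover: "col t a b \<and> t = p \<or> col t d e \<and> t = q \<or> col t f g \<and> t = r" if "t \<in> {1..3}" for t
    using assms[OF that] by (auto simp: col_def p_def q_def r_def)
  then have "{1..3} \<subseteq> {p, q, r}" by blast
  moreover have "{1..3} = {1, 2, 3::nat}" by auto
  ultimately have sub: "{1, 2, 3} \<subseteq> {p, q, r}" by simp
  moreover have "card {p, q, r} \<le> card {1, 2, 3::nat}" by (simp add: card_insert_if)
  ultimately have eq: "{p, q, r} = {1, 2, 3}"
    using card_seteq[of "{p, q, r}" "{1, 2, 3}"] by simp
  note pqr = three_of_three[OF eq]
  show thesis
    using that[OF eq] cover[OF pqr(4)] cover[OF pqr(5)] cover[OF pqr(6)] pqr(1-3) by blast
qed

lemma color_in_first_four:
  assumes "distinct vs" "set vs \<subseteq> verts G" "4 \<le> length vs" "t \<in> {1..3}"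
  shows "col t (vs ! 0) (vs ! 1) \<or> col t (vs ! 0) (vs ! 2) \<or> col t (vs ! 0) (vs ! 3)
    \<or> col t (vs ! 1) (vs ! 2) \<or> col t (vs ! 1) (vs ! 3) \<or> col t (vs ! 2) (vs ! 3)"
proof -
  obtain v w x y zs where "vs = v # w # x # y # zs"
    using assms(3) by (auto simp: numeral_eq_Suc Suc_le_length_iff)
  then show ?thesis using color_in_distinct_quad[of v w x y t] assms by simp
qed

lemma P4_colors:
  assumes "distinct vs" "set vs \<subseteq> verts G" "4 \<le> length vs"
    "{vs ! 0, vs ! 1} \<notin> edges G" "{vs ! 1, vs ! 2} \<notin> edges G" "{vs ! 2, vs ! 3} \<notin> edges G"
  obtains p q r where "{p, q, r} = {1, 2, 3::nat}"
    "col p (vs ! 0) (vs ! 2)" "col q (vs ! 0) (vs ! 3)" "col r (vs ! 1) (vs ! 3)"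
proof (rule colors_of_three_pairs)
  show "col t (vs ! 0) (vs ! 2) \<or> col t (vs ! 0) (vs ! 3) \<or> col t (vs ! 1) (vs ! 3)"
    if "t \<in> {1..3}" for t
    using color_in_first_four[OF assms(1-3) that] assms(4-6) by (auto simp: col_def)
qed

lemma K3_colors:
  assumes "distinct vs" "set vs \<subseteq> verts G" "4 \<le> length vs"
    "{vs ! 0, vs ! 1} \<notin> edges G" "{vs ! 1, vs ! 2} \<notin> edges G" "{vs ! 0, vs ! 2} \<notin> edges G"
  obtains p q r where "{p, q, r} = {1, 2, 3::nat}"
    "col p (vs ! 0) (vs ! 3)" "col q (vs ! 1) (vs ! 3)" "col r (vs ! 2) (vs ! 3)"
proof (rule colors_of_three_pairs)
  show "col t (vs ! 0) (vs ! 3) \<or> col t (vs ! 1) (vs ! 3) \<or> col t (vs ! 2) (vs ! 3)"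
    if "t \<in> {1..3}" for t
    using color_in_first_four[OF assms(1-3) that] assms(4-6) by (auto simp: col_def)
qed

lemma no_omitted_P4_P3:
  assumes "distinct vs" "set vs \<subseteq> verts G" "length vs = 7"
    "omits vs [(0, 1), (1, 2), (2, 3), (4, 5), (5, 6)]"
  shows False
proof -
  obtain p q r where pqr: "{p, q, r} = {1, 2, 3}"
    "col p (vs ! 0) (vs ! 2)" "col q (vs ! 0) (vs ! 3)" "col r (vs ! 1) (vs ! 3)"
    by (rule P4_colors[OF assms(1,2)]) (use assms in \<open>auto simp: omits_def\<close>)
  show False
    by (rule meets_quads_P4_P3[OF meets_quads_col[OF assms(1-3) pqr(1)] pqr(2-4) omits_col[OF assms(4)]])
qed

lemma no_omitted_C6:
  assumes "distinct vs" "set vs \<subseteq> verts G" "length vs = 8"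
    "omits vs [(0, 1), (1, 2), (2, 3), (3, 4), (4, 5), (0, 5)]"
  shows False
proof -
  obtain p q r where pqr: "{p, q, r} = {1, 2, 3}"
    "col p (vs ! 0) (vs ! 2)" "col q (vs ! 0) (vs ! 3)" "col r (vs ! 1) (vs ! 3)"
    by (rule P4_colors[OF assms(1,2)]) (use assms in \<open>auto simp: omits_def\<close>)
  show False
    by (rule meets_quads_C6[OF meets_quads_col[OF assms(1-3) pqr(1)] pqr(2-4) omits_col[OF assms(4)]])
qed

lemma no_omitted_P4:
  assumes "distinct vs" "set vs \<subseteq> verts G" "length vs = 9" "omits vs [(0, 1), (1, 2), (2, 3)]"
  shows False
proof -
  obtain p q r where pqr: "{p, q, r} = {1, 2, 3}"
    "col p (vs ! 0) (vs ! 2)" "col q (vs ! 0) (vs ! 3)" "col r (vs ! 1) (vs ! 3)"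
    by (rule P4_colors[OF assms(1,2)]) (use assms in \<open>auto simp: omits_def\<close>)
  show False
    by (rule meets_quads_P4[OF meets_quads_col[OF assms(1-3) pqr(1)] pqr(2-4) omits_col[OF assms(4)]])
qed

lemma no_omitted_K3_3K2:
  assumes "distinct vs" "set vs \<subseteq> verts G" "length vs = 9"
    "omits vs [(0, 1), (1, 2), (0, 2), (3, 4), (5, 6), (7, 8)]"
  shows False
proof -
  obtain p q r where pqr: "{p, q, r} = {1, 2, 3}"
    "col p (vs ! 0) (vs ! 3)" "col q (vs ! 1) (vs ! 3)" "col r (vs ! 2) (vs ! 3)"
    by (rule K3_colors[OF assms(1,2)]) (use assms in \<open>auto simp: omits_def\<close>)
  show False
    by (rule meets_quads_K3_3K2[OF meets_quads_col[OF assms(1-3) pqr(1)] pqr(2-4) omits_col[OF assms(4)]])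
qed

text \<open>Among the vertices not joined to \<open>v\<close> by color \<open>q\<close>, every triple contains color \<open>q\<close>; this is
  impossible for seven of them.\<close>

lemma color_degree_ge_3:
  assumes "W \<subseteq> verts G" "card W = 9" "v \<in> verts G - W" "{q, r, s} = {1, 2, 3}"
  shows "3 \<le> card {u \<in> W. col q v u}"
proof (rule ccontr)
  assume small: "\<not> ?thesis"
  \<comment> \<open>At most two of the nine vertices are removed, so seven remain.\<close>
  define W' where "W' = W - {u \<in> W. col q v u}"
  have fin: "finite W" using assms(1) finite_verts by (rule finite_subset)
  have W': "finite W'" "W' \<subseteq> verts G" "7 \<le> card W'"
    using fin small assms(1,2) by (auto simp: W'_def card_Diff_subset)
  note qrs = three_of_three[OF assms(4)]
  \<comment> \<open>Any quadruple in \<open>W'\<close> contains a pair of color \<open>r\<close>; it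
    goes to the front of the list to supply the atom \<open>B 0 1\<close>.\<close>
  obtain S where S: "S \<subseteq> W'" "card S = 4"
    using obtain_subset_with_card_n[of 4 W'] W'(3) by auto
  obtain a b where ab: "a \<in> S" "b \<in> S" "a \<noteq> b" "col r a b"
    using color_in_quad[of S r] S W'(2) qrs(5) by blast
  obtain ys where ys: "distinct ([a, b] @ ys)" "set ([a, b] @ ys) \<subseteq> W'" "length ([a, b] @ ys) = 7"
    using extend_distinct_list[of "[a, b]" W' 7] ab S W' by auto
  define vs where "vs = [a, b] @ ys"
  have vs: "distinct vs" "set vs \<subseteq> W'" "length vs = 7" using ys by (simp_all only: vs_def)
  have triple: "col q (vs ! i) (vs ! j) \<or> col q (vs ! i) (vs ! k) \<or> col q (vs ! j) (vs ! k)"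
    if "k < 7" "j < k" "i < j" for i j k
  proof -
    have mem: "vs ! i \<in> W'" "vs ! j \<in> W'" "vs ! k \<in> W'" using vs that by auto
    then have "distinct [v, vs ! i, vs ! j, vs ! k]"
      using vs that assms(3) by (auto simp: nth_eq_iff_index_eq W'_def)
    moreover have "{v, vs ! i, vs ! j, vs ! k} \<subseteq> verts G" using mem W'(2) assms(3) by auto
    moreover have "\<not> col q v (vs ! i)" "\<not> col q v (vs ! j)" "\<not> col q v (vs ! k)"
      using mem by (auto simp: W'_def)
    ultimately show ?thesis using color_in_distinct_quad[OF _ _ qrs(4)] by blast
  qed
  have "set vs \<subseteq> verts G" using vs(2) W'(2) by blast
  note meets = meets_quads_col[OF vs(1) this vs(3) assms(4)]
  have "col r (vs ! 0) (vs ! 1)" using ab(4) by (simp add: vs_def)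
  then show False by (rule meets_quads_7[OF meets, rotated]) (use triple in blast)
qed

text \<open>All three pairs at \<open>v\<close> have color \<open>q\<close>, so the other two colors
  of the quadruple occur inside \<open>M\<close>. Two different edges of a triangle share a vertex,
  which is named \<open>x\<close>.\<close>

lemma color_triangle:
  assumes "M \<subseteq> verts G" "card M = 3" "v \<in> verts G - M" "\<forall>u\<in>M. col q v u" "{q, r, s} = {1, 2, 3}"
  obtains x y z where "M = {x, y, z}" "distinct [x, y, z]" "col r x y" "col s x z"
proof -
  obtain x y z where M: "M = {x, y, z}" "x \<noteq> y" "x \<noteq> z" "y \<noteq> z"
    using assms(2) by (auto simp: card_Suc_eq numeral_3_eq_3)
  have quad: "distinct [v, x, y, z]" "{v, x, y, z} \<subseteq> verts G" using M assms by auto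
  note qrs = three_of_three[OF assms(5)]
  have "\<not> col r v u" "\<not> col s v u" if "u \<in> M" for u
    using assms(4) that qrs(1,2) by (auto simp: col_def)
  then have "col r x y \<or> col r x z \<or> col r y z" "col s x y \<or> col s x z \<or> col s y z"
    using color_in_distinct_quad[OF quad qrs(5)] color_in_distinct_quad[OF quad qrs(6)] M(1) by auto
  moreover have "\<not> (col r a b \<and> col s a b)" for a b using qrs(3) by (auto simp: col_def)
  moreover have "M = {x, z, y}" "M = {y, x, z}" "M = {y, z, x}" "M = {z, x, y}" "M = {z, y, x}"
    using M(1) by auto
  moreover have "distinct [x, y, z]" "distinct [x, z, y]" "distinct [y, x, z]" "distinct [y, z, x]"
    "distinct [z, x, y]" "distinct [z, y, x]"
    using M(2-4) by auto
  ultimately show thesis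
    using that[of x y z] that[of x z y] that[of y x z] that[of y z x] that[of z x y] that[of z y x]
      M(1) col_sym[of r x y] col_sym[of r x z] col_sym[of r y z]
      col_sym[of s x y] col_sym[of s x z] col_sym[of s y z] by metis
qed

text \<open>Among ten vertices every one has exactly three neighbors in each color, and two colors
  different from \<open>q\<close> occur inside the neighborhood in color \<open>q\<close>, hence on a path.\<close>

lemma order_le_9: "order G \<le> 9"
proof (rule ccontr)
  assume "\<not> ?thesis"
  then have n: "10 \<le> card (verts G)" by (simp add: order_def)
  then obtain v where v: "v \<in> verts G" by fastforce
  have "9 \<le> card (verts G - {v})" using n v finite_verts by simp
  then obtain W where W: "W \<subseteq> verts G - {v}" "card W = 9"
    using obtain_subset_with_card_n by metis
  have "3 \<le> card {u \<in> W. col q v u}" if "{q, r, s} = {1, 2, 3}" for q r s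
    using color_degree_ge_3[of W v, OF _ W(2) _ that] W v by blast
  then have M: "\<exists>M. M \<subseteq> {u \<in> W. col q v u} \<and> card M = 3" if "{q, r, s} = {1, 2, 3}" for q r s
    using obtain_subset_with_card_n that by metis
  have tri: "\<exists>x y z. {x, y, z} \<subseteq> {u \<in> W. col q v u} \<and> distinct [x, y, z] \<and> col r x y \<and> col s x z"
    if qrs: "{q, r, s} = {1, 2, 3}" for q r s
  proof -
    obtain M where M: "M \<subseteq> {u \<in> W. col q v u}" "card M = 3" using M[OF qrs] by blast
    have "M \<subseteq> verts G" "v \<in> verts G - M" "\<forall>u\<in>M. col q v u" using M(1) W(1) v by auto
    then obtain x y z where "M = {x, y, z}" "distinct [x, y, z]" "col r x y" "col s x z"
      using color_triangle[OF _ M(2) _ _ qrs] by metis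
    then show ?thesis using M(1) by blast
  qed
  obtain x1 y1 z1 where 1: "{x1, y1, z1} \<subseteq> {u \<in> W. col 1 v u}" "distinct [x1, y1, z1]"
    "col 2 x1 y1" "col 3 x1 z1" using tri[of 1 2 3] by auto
  obtain x2 y2 z2 where 2: "{x2, y2, z2} \<subseteq> {u \<in> W. col 2 v u}" "distinct [x2, y2, z2]"
    "col 1 x2 y2" "col 3 x2 z2" using tri[of 2 1 3] by auto
  obtain x3 y3 z3 where 3: "{x3, y3, z3} \<subseteq> {u \<in> W. col 3 v u}" "distinct [x3, y3, z3]"
    "col 1 x3 y3" "col 2 x3 z3" using tri[of 3 1 2] by auto
  \<comment> \<open>The three neighborhoods are disjoint because a pair at \<open>v\<close> has only
    one color. The order is that of the positions in \<open>meets_quads_10\<close>.\<close>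
  define vs where "vs = [v, x1, y1, z1, x2, y2, z2, x3, y3, z3]"
  have "distinct vs" using 1 2 3 W(1) by (auto simp: vs_def col_def)
  moreover have "set vs \<subseteq> verts G" using 1 2 3 W(1) v by (auto simp: vs_def)
  moreover have "length vs = 10" by (simp add: vs_def)
  ultimately have "meets_quads 10 (\<lambda>i j. col 1 (vs ! i) (vs ! j)) (\<lambda>i j. col 2 (vs ! i) (vs ! j))
    (\<lambda>i j. col 3 (vs ! i) (vs ! j))" by (rule meets_quads_col) simp
  then show False
    by (rule meets_quads_10) (use 1 2 3 in \<open>simp_all add: vs_def\<close>)
qed

end

section \<open>Graphs of maximum degree two\<close>

definition path_edges :: "'a list \<Rightarrow> 'a set set" where
  "path_edges p = {{p ! i, p ! Suc i} | i. Suc i < length p}"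

lemma path_edges_Cons:
  assumes "p \<noteq> []"
  shows "path_edges (x # p) = insert {x, hd p} (path_edges p)"
proof (rule set_eqI)
  fix e
  show "e \<in> path_edges (x # p) \<longleftrightarrow> e \<in> insert {x, hd p} (path_edges p)"
  proof
    assume "e \<in> path_edges (x # p)"
    then obtain i where "e = {(x # p) ! i, p ! i}" "i < length p" by (auto simp: path_edges_def)
    then show "e \<in> insert {x, hd p} (path_edges p)"
      using assms by (cases i) (auto simp: path_edges_def hd_conv_nth)
  next
    assume "e \<in> insert {x, hd p} (path_edges p)"
    then consider "e = {x, hd p}" | i where "e = {p ! i, p ! Suc i}" "Suc i < length p"
      by (auto simp: path_edges_def)
    then show "e \<in> path_edges (x # p)"
    proof cases
      case 1
      then show ?thesis using assms by (auto simp: path_edges_def hd_conv_nth intro!: exI[of _ 0])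
    next
      case 2
      then show ?thesis by (auto simp: path_edges_def intro!: exI[of _ "Suc i"])
    qed
  qed
qed

lemma path_edges_snoc:
  assumes "p \<noteq> []"
  shows "path_edges (p @ [x]) \<subseteq> insert {last p, x} (path_edges p)"
proof
  fix e assume "e \<in> path_edges (p @ [x])"
  then obtain i where i: "i < length p" "e = {(p @ [x]) ! i, (p @ [x]) ! Suc i}"
    by (auto simp: path_edges_def)
  show "e \<in> insert {last p, x} (path_edges p)"
  proof (cases "Suc i < length p")
    case True
    then show ?thesis using i by (auto simp: path_edges_def nth_append)
  next
    case False
    then have "i = length p - 1" "Suc i = length p" using i(1) by auto
    then show ?thesis using i assms by (simp add: nth_append last_conv_nth)
  qed
qed

text \<open>Each list runs through one component. For a cycle it starts anywhere, and the closing
  edge is the only edge that the list does not show. Below length 3 a closing pair would be a single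
  vertex or the path edge itself.\<close>

definition component_paths :: "'a sgraph \<Rightarrow> 'a list list \<Rightarrow> bool" where
  "component_paths H pss \<longleftrightarrow> distinct (concat pss) \<and> set (concat pss) = verts H \<and> [] \<notin> set pss \<and>
     (\<forall>p\<in>set pss. path_edges p \<subseteq> edges H) \<and>
     (\<forall>e\<in>edges H. \<exists>p\<in>set pss. e \<in> path_edges p \<or> 3 \<le> length p \<and> e = {hd p, last p})"

definition max_degree_2 :: "'a sgraph \<Rightarrow> bool" where
  "max_degree_2 H \<longleftrightarrow> (\<forall>v x y z. {v, x} \<in> edges H \<and> {v, y} \<in> edges H \<and> {v, z} \<in> edges H
     \<longrightarrow> x = y \<or> x = z \<or> y = z)"

lemma max_degree_2_mono:
  assumes "max_degree_2 H" "edges H' \<subseteq> edges H"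
  shows "max_degree_2 H'"
  using assms unfolding max_degree_2_def by (meson subsetD)

definition maximal_path :: "'a sgraph \<Rightarrow> 'a list \<Rightarrow> bool" where
  "maximal_path H p \<longleftrightarrow> p \<noteq> [] \<and> distinct p \<and> set p \<subseteq> verts H \<and> path_edges p \<subseteq> edges H \<and>
     (\<forall>q. distinct q \<and> set q \<subseteq> verts H \<and> path_edges q \<subseteq> edges H \<longrightarrow> length q \<le> length p)"

lemma maximal_path_exists:
  assumes "finite (verts H)" "verts H \<noteq> {}"
  shows "\<exists>p. maximal_path H p"
proof -
  let ?P = "\<lambda>p. distinct p \<and> set p \<subseteq> verts H \<and> path_edges p \<subseteq> edges H"
  obtain v where v: "v \<in> verts H" using assms(2) by blast
  have "?P [v]" using v by (simp add: path_edges_def)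
  moreover have "\<forall>p. ?P p \<longrightarrow> length p < Suc (card (verts H))"
    using card_mono[OF assms(1)] distinct_card less_Suc_eq_le by metis
  ultimately have "\<exists>p. ?P p \<and> (\<forall>q. ?P q \<longrightarrow> length q \<le> length p)"
    using ex_has_greatest_nat[of ?P "[v]" length] by blast
  then obtain p where p: "?P p" "\<forall>q. ?P q \<longrightarrow> length q \<le> length p" by blast
  have "length [v] \<le> length p" using p(2) \<open>?P [v]\<close> by blast
  then have "p \<noteq> []" by auto
  then show ?thesis using p unfolding maximal_path_def by blast
qed

text \<open>A neighbor outside the path would extend it at an end, or be a third neighbor of an
  inner vertex.\<close>

lemma maximal_path_closed:
  assumes "simple_graph H" "max_degree_2 H" "maximal_path H p" "{x, y} \<in> edges H" "x \<in> set p"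
  shows "y \<in> set p"
proof (rule ccontr)
  assume y: "y \<notin> set p"
  have p: "p \<noteq> []" "distinct p" "set p \<subseteq> verts H" "path_edges p \<subseteq> edges H"
    and longest: "\<And>q. distinct q \<Longrightarrow> set q \<subseteq> verts H \<Longrightarrow> path_edges q \<subseteq> edges H
      \<Longrightarrow> length q \<le> length p"
    using assms(3) by (auto simp: maximal_path_def)
  have yV: "y \<in> verts H" using edge_in_simple_graph[OF assms(1,4)] by simp
  obtain i where i: "i < length p" "x = p ! i" using assms(5) by (auto simp: in_set_conv_nth)
  show False
  proof (cases "i = 0 \<or> Suc i = length p")
    case True
    then show False
    proof
      assume "i = 0"
      then have "{y, hd p} \<in> edges H" using assms(4) i p(1) by (simp add: hd_conv_nth insert_commute)
      then have "path_edges (y # p) \<subseteq> edges H" using p by (simp add: path_edges_Cons)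
      then show False using longest[of "y # p"] p y yV by simp
    next
      assume "Suc i = length p"
      then have "{last p, y} \<in> edges H" using assms(4) i p(1)
        by (metis diff_Suc_1 last_conv_nth)
      then have "path_edges (p @ [y]) \<subseteq> edges H" using p path_edges_snoc[of p y] by blast
      then show False using longest[of "p @ [y]"] p y yV by simp
    qed
  next
    case False
    then obtain k where k: "i = Suc k" "Suc i < length p" using i by (cases i) auto
    have "{p ! k, p ! i} \<in> path_edges p" "{p ! i, p ! Suc i} \<in> path_edges p"
      using k i by (auto simp: path_edges_def)
    then have "{x, p ! k} \<in> edges H" "{x, p ! Suc i} \<in> edges H"
      using p(4) i(2) by (auto simp: insert_commute)
    then have "p ! k = p ! Suc i \<or> p ! k = y \<or> p ! Suc i = y"
      using assms(2,4) unfolding max_degree_2_def by blast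
    then show False using y k i p(2) by (auto simp: nth_eq_iff_index_eq)
  qed
qed

text \<open>An inner vertex already has its two neighbors on the path, so any further edge between
  path vertices joins the two ends.\<close>

lemma maximal_path_chord:
  assumes "max_degree_2 H" "maximal_path H p" "{p ! i, p ! j} \<in> edges H" "i < j" "j < length p"
  shows "j = Suc i \<or> i = 0 \<and> Suc j = length p"
proof (rule ccontr)
  assume neg: "\<not> ?thesis"
  have p: "distinct p" "path_edges p \<subseteq> edges H"
    using assms(2) by (auto simp: maximal_path_def)
  have "p \<noteq> []" using assms(5) by auto
  have edge: "{p ! k, p ! Suc k} \<in> edges H" if "Suc k < length p" for k
    using that p(2) by (auto simp: path_edges_def)
  have deg: "x = y \<or> x = z \<or> y = z"
    if "{v, x} \<in> edges H" "{v, y} \<in> edges H" "{v, z} \<in> edges H" for v x y z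
    using assms(1) that unfolding max_degree_2_def by blast
  show False
  proof (cases i)
    case 0
    obtain k where k: "j = Suc k" using assms(4) by (cases j) auto
    have "{p ! j, p ! k} \<in> edges H" "{p ! j, p ! Suc j} \<in> edges H" "{p ! j, p ! i} \<in> edges H"
      using edge[of k] edge[of j] assms(3,5) k neg 0 by (auto simp: insert_commute)
    from deg[OF this] show False
      using nth_eq_iff_index_eq[OF p(1), of k "Suc j"] nth_eq_iff_index_eq[OF p(1), of k 0]
        nth_eq_iff_index_eq[OF p(1), of "Suc j" 0] assms(4,5) neg k 0 \<open>p \<noteq> []\<close> by auto
  next
    case (Suc k)
    have "{p ! i, p ! k} \<in> edges H" "{p ! i, p ! Suc i} \<in> edges H" "{p ! i, p ! j} \<in> edges H"
      using edge[of k] edge[of i] assms(3-5) Suc by (auto simp: insert_commute)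
    from deg[OF this] show False
      using nth_eq_iff_index_eq[OF p(1), of k "Suc i"] nth_eq_iff_index_eq[OF p(1), of k j]
        nth_eq_iff_index_eq[OF p(1), of "Suc i" j] assms(4,5) neg Suc by auto
  qed
qed

lemma maximal_path_edges:
  assumes "simple_graph H" "max_degree_2 H" "maximal_path H p" "e \<in> edges H" "e \<inter> set p \<noteq> {}"
  shows "e \<in> path_edges p \<or> 3 \<le> length p \<and> e = {hd p, last p}"
proof -
  obtain x y where e: "e = {x, y}" "x \<noteq> y" using assms(1,4) by (rule edge_of_simple_graph)
  have "{x, y} \<in> edges H" "{y, x} \<in> edges H" using assms(4) e(1) by (auto simp: insert_commute)
  then have "x \<in> set p" "y \<in> set p"
    using maximal_path_closed[OF assms(1-3)] assms(5) e(1) by blast+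
  then obtain i j where "i < length p" "j < length p" "x = p ! i" "y = p ! j"
    by (auto simp: in_set_conv_nth)
  then obtain i j where ij: "i < j" "j < length p" "e = {p ! i, p ! j}"
    using e by (metis insert_commute linorder_neqE_nat)
  have "p \<noteq> []" using ij by auto
  from maximal_path_chord[OF assms(2,3) _ ij(1,2)] assms(4) ij(3)
  consider "j = Suc i" | "j \<noteq> Suc i" "i = 0" "Suc j = length p" by auto
  then show ?thesis
  proof cases
    case 1
    then show ?thesis using ij by (auto simp: path_edges_def)
  next
    case 2
    then have "j = length p - 1" "3 \<le> length p" using ij(1) by auto
    then show ?thesis using ij(3) 2 \<open>p \<noteq> []\<close> by (simp add: hd_conv_nth last_conv_nth)
  qed
qed

text \<open>A longest path exhausts its component, so removing its vertices cuts no edge and the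
  induction applies to the rest.\<close>

lemma component_paths_exist:
  assumes "simple_graph H" "max_degree_2 H"
  shows "\<exists>pss. component_paths H pss"
  using assms
proof (induction "card (verts H)" arbitrary: H rule: less_induct)
  case less
  have fin: "finite (verts H)" using less.prems(1) by (simp add: simple_graph_def)
  show ?case
  proof (cases "verts H = {}")
    case True
    then have "edges H = {}" using less.prems(1) by (auto simp: simple_graph_def)
    then have "component_paths H []" using True by (simp add: component_paths_def)
    then show ?thesis ..
  next
    case False
    obtain p where p: "maximal_path H p" using maximal_path_exists[OF fin False] ..
    then have p': "p \<noteq> []" "distinct p" "set p \<subseteq> verts H" "path_edges p \<subseteq> edges H"
      by (auto simp: maximal_path_def)
    define H' where "H' = \<lparr>verts = verts H - set p, edges = {e \<in> edges H. e \<inter> set p = {}}\<rparr>"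
    have "card (verts H') < card (verts H)"
    proof (rule psubset_card_mono[OF fin])
      show "verts H' \<subset> verts H"
        using p'(3) hd_in_set[OF p'(1)] unfolding H'_def by fastforce
    qed
    moreover have "simple_graph H'"
      unfolding simple_graph_def
    proof (intro conjI subsetI)
      fix e assume "e \<in> edges H'"
      then have e: "e \<in> edges H" "e \<inter> set p = {}" by (simp_all add: H'_def)
      obtain x y where "e = {x, y}" "x \<in> verts H" "y \<in> verts H" "x \<noteq> y"
        using less.prems(1) e(1) by (rule edge_of_simple_graph)
      then show "e \<in> {{u, v} |u v. u \<in> verts H' \<and> v \<in> verts H' \<and> u \<noteq> v}"
        using e(2) by (auto simp: H'_def)
    qed (simp add: H'_def fin)
    moreover have "max_degree_2 H'"
      using less.prems(2) by (rule max_degree_2_mono) (auto simp: H'_def)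
    ultimately obtain pss where pss: "component_paths H' pss" using less.hyps by blast
    have "component_paths H (p # pss)"
      unfolding component_paths_def
    proof (intro conjI ballI)
      show "distinct (concat (p # pss))" "set (concat (p # pss)) = verts H"
        using pss p' by (auto simp: component_paths_def H'_def)
      show "[] \<notin> set (p # pss)" using pss p' by (auto simp: component_paths_def)
      show "path_edges q \<subseteq> edges H" if "q \<in> set (p # pss)" for q
        using that pss p' by (auto simp: component_paths_def H'_def)
      fix e assume e: "e \<in> edges H"
      show "\<exists>q\<in>set (p # pss). e \<in> path_edges q \<or> 3 \<le> length q \<and> e = {hd q, last q}"
      proof (cases "e \<inter> set p = {}")
        case True
        then have "e \<in> edges H'" using e by (simp add: H'_def)
        then show ?thesis using pss by (auto simp: component_paths_def)
      next
        case False
        then show ?thesis using maximal_path_edges[OF less.prems p e] by auto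
      qed
    qed
    then show ?thesis ..
  qed
qed

text \<open>Pairing each list with its length lets a permutation of the lengths carry the lists
  along.\<close>

lemma component_paths_reorder:
  assumes "component_paths H pss" "mset ls = mset (map length pss)"
  obtains pss' where "component_paths H pss'" "set pss' = set pss" "map length pss' = ls"
proof -
  have "length (map length pss) = length pss" by simp
  then obtain pss' where pss': "length pss' = length ls"
    "mset (zip ls pss') = mset (zip (map length pss) pss)"
    using ex_mset_zip_left[of "map length pss" pss ls] assms(2) by auto
  have "mset (map snd (zip ls pss')) = mset (map snd (zip (map length pss) pss))"
    using pss'(2) by (metis mset_map)
  then have m: "mset pss' = mset pss" using pss'(1) by simp
  have "set (zip ls pss') = set (zip (map length pss) pss)" using pss'(2) by (metis set_mset_mset)
  then have lp: "l = length p" if "(l, p) \<in> set (zip ls pss')" for l p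
    using that by (auto simp: zip_map1 set_zip)
  have "length (pss' ! i) = ls ! i" if "i < length ls" for i
    using lp[of "ls ! i" "pss' ! i"] that pss'(1) by (force simp: set_zip)
  then have "map length pss' = ls"
    using pss'(1) by (intro nth_equalityI) auto
  moreover have "set pss' = set pss" using m by (rule mset_eq_setD)
  moreover have "mset (concat pss') = mset (concat pss)"
    using m by (metis mset_concat mset_map sum_mset_sum_list)
  then have "distinct (concat pss') = distinct (concat pss)" by (rule mset_eq_imp_distinct_iff)
  then have "component_paths H pss'"
    using assms(1) \<open>set pss' = set pss\<close> unfolding component_paths_def by simp
  ultimately show thesis using that by blast
qed

section \<open>Components on consecutive positions\<close>

definition block :: "nat list \<Rightarrow> nat \<Rightarrow> nat \<Rightarrow> (nat \<times> nat) list" where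
  "block cs k m = map (\<lambda>i. (k + i, k + Suc i)) [0..<m - 1] @ (if m \<in> set cs then [(k, k + m - 1)] else [])"

text \<open>The list \<open>cs\<close> holds the orders of the components that are cycles rather than paths. For order 3
  this turns \<open>K\<^sub>2\<close> and \<open>K\<^sub>3\<close> into components of the same layout.\<close>

fun layout :: "nat list \<Rightarrow> nat \<Rightarrow> nat list \<Rightarrow> (nat \<times> nat) list" where
  "layout cs k [] = []"
| "layout cs k (m # ms) = block cs k m @ layout cs (k + m) ms"

text \<open>An embedding replaced by an enumeration of the vertices. Padding vertices need no
  mention: their positions occur in no pair.\<close>

definition fits :: "'a sgraph \<Rightarrow> (nat \<times> nat) list \<Rightarrow> bool" where
  "fits H ps \<longleftrightarrow> (\<exists>vs. distinct vs \<and> set vs = verts H \<and>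
     edges H \<subseteq> (\<lambda>(i, j). {vs ! i, vs ! j}) ` set ps)"

lemma edge_in_block:
  assumes "e \<in> path_edges p \<or> p \<noteq> [] \<and> length p \<in> set cs \<and> e = {hd p, last p}"
  shows "e \<in> (\<lambda>(i, j). {(xs @ p @ ys) ! i, (xs @ p @ ys) ! j}) ` set (block cs (length xs) (length p))"
  using assms
proof
  assume "e \<in> path_edges p"
  then obtain i where i: "Suc i < length p" "e = {p ! i, p ! Suc i}" by (auto simp: path_edges_def)
  then have "(length xs + i, length xs + Suc i) \<in> set (block cs (length xs) (length p))"
    by (auto simp: block_def)
  moreover have "e = {(xs @ p @ ys) ! (length xs + i), (xs @ p @ ys) ! (length xs + Suc i)}"
    using i by (auto simp: nth_append)
  ultimately show ?thesis by force
next
  assume e: "p \<noteq> [] \<and> length p \<in> set cs \<and> e = {hd p, last p}"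
  then have "(length xs, length xs + length p - 1) \<in> set (block cs (length xs) (length p))"
    by (auto simp: block_def)
  moreover have "length xs + length p - 1 = length xs + (length p - 1)"
    using e by (cases p) auto
  then have "(xs @ p @ ys) ! (length xs) = hd p"
    "(xs @ p @ ys) ! (length xs + length p - 1) = last p"
    using e by (simp_all add: nth_append hd_conv_nth last_conv_nth)
  then have "e = {(xs @ p @ ys) ! (length xs), (xs @ p @ ys) ! (length xs + length p - 1)}"
    using e by simp
  ultimately show ?thesis by force
qed

text \<open>The prefix \<open>xs\<close> carries the offset of the layout through the
  induction.\<close>

lemma edge_in_layout:
  assumes "q \<in> set pss" "e \<in> path_edges q \<or> q \<noteq> [] \<and> length q \<in> set cs \<and> e = {hd q, last q}"
  shows "e \<in> (\<lambda>(i, j). {(xs @ concat pss) ! i, (xs @ concat pss) ! j}) `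
    set (layout cs (length xs) (map length pss))"
  using assms(1)
proof (induction pss arbitrary: xs)
  case (Cons p pss)
  show ?case
  proof (cases "q = p")
    case True
    then show ?thesis
      using edge_in_block[of e p cs xs "concat pss"] assms(2) by (simp add: image_Un)
  next
    case False
    then show ?thesis using Cons.IH[of "xs @ p"] Cons.prems by (simp add: image_Un)
  qed
qed simp

text \<open>The list \<open>cs\<close> may overestimate: a path component whose order is in
  \<open>cs\<close> is given the closing pair as well, which only enlarges the layout. Hence only
  the closed components have to be checked against \<open>cs\<close>.\<close>

lemma fits_layout:
  assumes "component_paths H pss" "mset ls = mset (map length pss)"
    and closed: "\<And>p. p \<in> set pss \<Longrightarrow> 3 \<le> length p \<Longrightarrow> {hd p, last p} \<in> edges H \<Longrightarrow> length p \<in> set cs"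
    and "set (layout cs 0 ls) \<subseteq> set ps"
  shows "fits H ps"
proof -
  obtain pss' where pss': "component_paths H pss'" "set pss' = set pss" "map length pss' = ls"
    using component_paths_reorder[OF assms(1,2)] by blast
  have "e \<in> (\<lambda>(i, j). {concat pss' ! i, concat pss' ! j}) ` set (layout cs 0 ls)" if e: "e \<in> edges H" for e
  proof -
    obtain p where p: "p \<in> set pss'" "e \<in> path_edges p \<or> 3 \<le> length p \<and> e = {hd p, last p}"
      using e pss'(1) unfolding component_paths_def by blast
    then have "e \<in> path_edges p \<or> p \<noteq> [] \<and> length p \<in> set cs \<and> e = {hd p, last p}"
      using closed[of p] e pss'(2) by auto
    from edge_in_layout[OF p(1) this, of "[]"] show ?thesis using pss'(3) by simp
  qed
  then have "edges H \<subseteq> (\<lambda>(i, j). {concat pss' ! i, concat pss' ! j}) ` set ps"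
    using assms(4) by blast
  then show ?thesis using pss'(1) unfolding fits_def component_paths_def by blast
qed

section \<open>Subgraphs up to isomorphism\<close>

text \<open>As \<open>h\<close> is injective only on the vertices, the condition with
  \<open>Pow\<close> is what allows an edge to be recovered from its image.\<close>

definition numbered :: "'a sgraph \<Rightarrow> nat \<Rightarrow> (nat \<times> nat) list \<Rightarrow> bool" where
  "numbered F m ps \<longleftrightarrow> (\<exists>h. bij_betw h (verts F) {..<m} \<and> edges F \<subseteq> Pow (verts F) \<and>
     (\<lambda>e. h ` e) ` edges F = (\<lambda>(i, j). {i, j}) ` set ps)"

lemma numbered_id:
  assumes "verts F = {..<m}" "edges F \<subseteq> Pow {..<m}" "edges F = (\<lambda>(i, j). {i, j}) ` set ps"
  shows "numbered F m ps"
  unfolding numbered_def using assms by (intro exI[of _ id]) auto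

lemma numbered_path_graph: "numbered (path_graph m) m (layout [] 0 [m])"
  by (rule numbered_id) (auto simp: path_graph_def block_def image_image)

lemma numbered_cycle_graph:
  assumes "0 < m"
  shows "numbered (cycle_graph m) m (layout [m] 0 [m])"
proof (rule numbered_id)
  \<comment> \<open>The last index is split off, because only there does \<open>Suc i mod m\<close>
    wrap around to 0.\<close>
  have "{..<m} = insert (m - 1) {0..<m - 1}" using assms by auto
  moreover have "edges (cycle_graph m) = (\<lambda>i. {i, Suc i mod m}) ` {..<m}"
    unfolding cycle_graph_def lessThan_def by (simp add: setcompr_eq_image)
  ultimately have "edges (cycle_graph m) = (\<lambda>i. {i, Suc i mod m}) ` insert (m - 1) {0..<m - 1}"
    by (simp only:)
  also have "\<dots> = insert {0, m - 1} ((\<lambda>i. {i, Suc i mod m}) ` {0..<m - 1})"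
    using assms by (simp add: insert_commute)
  also have "(\<lambda>i. {i, Suc i mod m}) ` {0..<m - 1} = (\<lambda>i. {i, Suc i}) ` {0..<m - 1}"
    by (intro image_cong) auto
  finally show "edges (cycle_graph m) = (\<lambda>(i, j). {i, j}) ` set (layout [m] 0 [m])"
    by (simp add: block_def image_image)
qed (use assms in \<open>auto simp: cycle_graph_def\<close>)

lemma numbered_complete_graph_2: "numbered (complete_graph 2) 2 (layout [3] 0 [2])"
proof (rule numbered_id)
  have "edges (complete_graph 2) = {{0, 1}}"
    by (auto simp: complete_graph_def less_2_cases_iff)
  also have "\<dots> = (\<lambda>(i, j). {i, j}) ` set (layout [3] 0 [2])"
    by (simp add: block_def)
  finally show "edges (complete_graph 2) = (\<lambda>(i, j). {i, j}) ` set (layout [3] 0 [2])" .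
qed (auto simp: complete_graph_def)

lemma numbered_complete_graph_3: "numbered (complete_graph 3) 3 (layout [3] 0 [3])"
proof (rule numbered_id)
  have cases: "i < 3 \<longleftrightarrow> i = 0 \<or> i = 1 \<or> i = (2::nat)" for i by auto
  have "edges (complete_graph 3) = {{0, 1}, {1, 2}, {0, 2}}"
  proof (intro equalityI subsetI)
    fix e assume "e \<in> edges (complete_graph 3)"
    then obtain i j where "e = {i, j}" "i < 3" "j < 3" "i \<noteq> j" by (auto simp: complete_graph_def)
    then show "e \<in> {{0, 1}, {1, 2}, {0, 2}}" unfolding cases by (elim disjE) auto
  next
    fix e :: "nat set" assume "e \<in> {{0, 1}, {1, 2}, {0, 2}}"
    then have "\<exists>i j. e = {i, j} \<and> i < 3 \<and> j < 3 \<and> i \<noteq> j"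
      by (elim insertE emptyE; intro exI conjI) (assumption | simp)+
    then show "e \<in> edges (complete_graph 3)" by (simp add: complete_graph_def)
  qed
  also have "\<dots> = (\<lambda>(i, j). {i, j}) ` set (layout [3] 0 [3])"
    by (simp add: block_def numeral_2_eq_2)
  finally show "edges (complete_graph 3) = (\<lambda>(i, j). {i, j}) ` set (layout [3] 0 [3])" .
qed (auto simp: complete_graph_def)

definition shift :: "nat \<Rightarrow> (nat \<times> nat) list \<Rightarrow> (nat \<times> nat) list" where
  "shift k ps = map (\<lambda>(i, j). (k + i, k + j)) ps"

lemma shift_pairs: "(\<lambda>(i, j). {i, j}) ` set (shift k ps) = (`) ((+) k) ` (\<lambda>(i, j). {i, j}) ` set ps"
  by (simp add: shift_def image_image case_prod_unfold)

lemma bij_betw_shift: "bij_betw ((+) k) {..<m} {k..<k + m::nat}"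
  by (simp add: bij_betw_def lessThan_atLeast0 add.commute)

lemma numbered_disjoint_union:
  assumes "numbered F m ps" "numbered F' m' ps'"
  shows "numbered (F \<uplus> F') (m + m') (ps @ shift m ps')"
proof -
  obtain h where h: "bij_betw h (verts F) {..<m}" "edges F \<subseteq> Pow (verts F)"
    "(`) h ` edges F = (\<lambda>(i, j). {i, j}) ` set ps" using assms(1) by (auto simp: numbered_def)
  obtain h' where h': "bij_betw h' (verts F') {..<m'}" "edges F' \<subseteq> Pow (verts F')"
    "(`) h' ` edges F' = (\<lambda>(i, j). {i, j}) ` set ps'" using assms(2) by (auto simp: numbered_def)
  define g where "g = case_sum h (\<lambda>x. m + h' x)"
  have "bij_betw g (Inl ` verts F) {..<m}"
    using h(1) by (auto simp: bij_betw_def inj_on_def g_def image_image)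
  moreover have "bij_betw g (Inr ` verts F') {m..<m + m'}"
  proof -
    have "(\<lambda>x. m + h' x) ` verts F' = (+) m ` h' ` verts F'" by (simp add: image_image)
    also have "\<dots> = {m..<m + m'}" using h'(1) bij_betw_shift by (simp add: bij_betw_def)
    finally show ?thesis using h'(1) by (auto simp: bij_betw_def inj_on_def g_def image_image)
  qed
  ultimately have "bij_betw g (Inl ` verts F \<union> Inr ` verts F') ({..<m} \<union> {m..<m + m'})"
    by (rule bij_betw_combine) auto
  moreover have "{..<m} \<union> {m..<m + m'} = {..<m + m'}" by auto
  moreover have "(`) g ` edges (F \<uplus> F') = (\<lambda>(i, j). {i, j}) ` set (ps @ shift m ps')"
  proof -
    have "(`) g ` edges (F \<uplus> F') = (`) h ` edges F \<union> (`) ((+) m) ` (`) h' ` edges F'"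
      by (simp add: disjoint_union_def image_Un image_image g_def)
    also have "\<dots> = (\<lambda>(i, j). {i, j}) ` set ps \<union> (\<lambda>(i, j). {i, j}) ` set (shift m ps')"
      unfolding h(3) h'(3) shift_pairs ..
    finally show ?thesis by (simp add: image_Un)
  qed
  moreover have "edges (F \<uplus> F') \<subseteq> Pow (verts (F \<uplus> F'))"
    using h(2) h'(2) by (auto simp: disjoint_union_def)
  moreover have "verts (F \<uplus> F') = Inl ` verts F \<union> Inr ` verts F'"
    by (auto simp: disjoint_union_def)
  ultimately show ?thesis unfolding numbered_def by auto
qed

text \<open>The number of the copy and the number inside the copy are quotient and remainder modulo
  \<open>m\<close>.\<close>

lemma numbered_copies:
  assumes "numbered F m ps"
  shows "numbered (copies t F) (t * m) (concat (map (\<lambda>k. shift (k * m) ps) [0..<t]))"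
proof -
  obtain h where h: "bij_betw h (verts F) {..<m}" "edges F \<subseteq> Pow (verts F)"
    "(`) h ` edges F = (\<lambda>(i, j). {i, j}) ` set ps" using assms by (auto simp: numbered_def)
  define g where "g = (\<lambda>(k, x). k * m + h x)"
  have lt: "h x < m" if "x \<in> verts F" for x using h(1) that by (auto simp: bij_betw_def)
  have "bij_betw g ({..<t} \<times> verts F) {..<t * m}"
  proof (rule bij_betw_imageI)
    show "inj_on g ({..<t} \<times> verts F)"
    proof (rule inj_onI, clarify)
      fix k x k' x' assume *: "g (k, x) = g (k', x')" "x \<in> verts F" "x' \<in> verts F"
      have div: "g (k, x) div m = k" "g (k, x) mod m = h x" if "x \<in> verts F" for k x
        using lt[OF that] by (auto simp: g_def)
      have "k = k'" "h x = h x'" using div[OF *(2)] div[OF *(3)] *(1) by metis+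
      then show "k = k' \<and> x = x'" using h(1) *(2,3) by (auto simp: bij_betw_def inj_on_def)
    qed
    show "g ` ({..<t} \<times> verts F) = {..<t * m}"
    proof (intro equalityI subsetI)
      fix y assume "y \<in> g ` ({..<t} \<times> verts F)"
      then obtain k x where k: "k < t" "x \<in> verts F" "y = k * m + h x" by (auto simp: g_def)
      have "k * m + h x < Suc k * m" using lt[OF k(2)] by simp
      also have "\<dots> \<le> t * m" using k(1) by (intro mult_le_mono1) simp
      finally show "y \<in> {..<t * m}" using k(3) by simp
    next
      fix y assume y: "y \<in> {..<t * m}"
      then have m: "0 < m" by (cases m) auto
      have "y mod m \<in> h ` verts F" using h(1) m by (simp add: bij_betw_def)
      then obtain x where x: "x \<in> verts F" "h x = y mod m" by auto
      have "y div m < t" using y m by (simp add: div_less_iff_less_mult)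
      moreover have "y = g (y div m, x)" using x by (simp add: g_def)
      ultimately show "y \<in> g ` ({..<t} \<times> verts F)" using x(1) by blast
    qed
  qed
  moreover have "(`) g ` edges (copies t F)
    = (\<lambda>(i, j). {i, j}) ` set (concat (map (\<lambda>k. shift (k * m) ps) [0..<t]))"
  proof -
    have "(`) g ` (`) (Pair k) ` edges F = (\<lambda>(i, j). {i, j}) ` set (shift (k * m) ps)" for k
    proof -
      have "(`) g ` (`) (Pair k) ` edges F = (`) ((+) (k * m)) ` (`) h ` edges F"
        by (simp add: image_image g_def)
      then show ?thesis unfolding h(3) shift_pairs .
    qed
    then show ?thesis by (simp add: copies_def image_UN atLeast0LessThan)
  qed
  moreover have "edges (copies t F) \<subseteq> Pow (verts (copies t F))"
    using h(2) by (fastforce simp: copies_def)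
  moreover have "verts (copies t F) = {..<t} \<times> verts F"
    by (simp add: copies_def)
  ultimately show ?thesis unfolding numbered_def by auto
qed

lemma numbered_order:
  assumes "numbered F m ps"
  shows "order F = m" "finite (verts F)"
proof -
  obtain h where h: "bij_betw h (verts F) {..<m}" using assms by (auto simp: numbered_def)
  show "order F = m" using bij_betw_same_card[OF h] by (simp add: order_def)
  show "finite (verts F)" using bij_betw_finite[OF h] by simp
qed

lemma is_subgraph_of_imp_fits:
  assumes "simple_graph H" "numbered F m ps" "m \<le> order H" "is_subgraph_of H F"
  shows "fits H ps"
proof -
  define n where "n = order H"
  let ?F = "F \<uplus> edgeless_graph (n - m)"
  have "numbered (edgeless_graph (n - m)) (n - m) []"
    by (rule numbered_id) (auto simp: edgeless_graph_def)
  from numbered_disjoint_union[OF assms(2) this]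
  have F: "numbered ?F n ps" using assms(3) by (simp add: n_def shift_def)
  then obtain h where h: "bij_betw h (verts ?F) {..<n}" "edges ?F \<subseteq> Pow (verts ?F)"
    "(`) h ` edges ?F = (\<lambda>(i, j). {i, j}) ` set ps" by (auto simp: numbered_def)
  obtain H' f where H': "subgraph H' ?F" and f: "bij_betw f (verts H) (verts H')"
    "edges H' = (`) f ` edges H"
    using assms(4) numbered_order[OF assms(2)] by (auto simp: is_subgraph_of_def isomorphic_def n_def)
  \<comment> \<open>Padding gives both graphs \<open>n\<close> vertices, so \<open>H'\<close> is a
    spanning subgraph and \<open>h\<close> numbers all of it.\<close>
  have "card (verts H') = n" using bij_betw_same_card[OF f(1)] by (simp add: n_def order_def)
  then have "verts H' = verts ?F"
    using H' numbered_order[OF F] by (intro card_subset_eq) (auto simp: subgraph_def order_def)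
  then have g: "bij_betw (h \<circ> f) (verts H) {..<n}" using bij_betw_trans[OF f(1)] h(1) by simp
  define vs where "vs = map (inv_into (verts H) (h \<circ> f)) [0..<n]"
  have vs_set: "set vs = verts H"
    using bij_betw_inv_into[OF g] by (simp add: vs_def bij_betw_def atLeast0LessThan)
  have "distinct vs"
    using bij_betw_inv_into[OF g] by (simp add: vs_def bij_betw_def distinct_map atLeast0LessThan)
  moreover have nth: "vs ! (h (f v)) = v" if "v \<in> verts H" for v
  proof -
    have "h (f v) < n" using bij_betwE[OF g] that by auto
    then show ?thesis using bij_betw_inv_into_left[OF g that] by (simp add: vs_def)
  qed
  have "e \<in> (\<lambda>(i, j). {vs ! i, vs ! j}) ` set ps" if e: "e \<in> edges H" for e
  proof -
    have "f ` e \<in> edges ?F" using e f(2) H' by (auto simp: subgraph_def)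
    then have "h ` f ` e \<in> (\<lambda>(i, j). {i, j}) ` set ps" using h(3) by blast
    then obtain i j where ij: "(i, j) \<in> set ps" "h ` f ` e = {i, j}" by auto
    have "e \<subseteq> verts H" using e assms(1) by (auto elim: edge_of_simple_graph)
    then have "(!) vs ` h ` f ` e = e" using nth by (force simp: image_image)
    then have "e = {vs ! i, vs ! j}" using ij(2) by simp
    then show ?thesis using ij(1) by force
  qed
  ultimately show ?thesis using vs_set unfolding fits_def by blast
qed

lemma fits_imp_is_subgraph_of:
  assumes "simple_graph H" "numbered F m ps" "m \<le> order H" "fits H ps"
  shows "is_subgraph_of H F"
proof -
  define n where "n = order H"
  let ?F = "F \<uplus> edgeless_graph (n - m)"
  have "numbered (edgeless_graph (n - m)) (n - m) []"
    by (rule numbered_id) (auto simp: edgeless_graph_def)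
  from numbered_disjoint_union[OF assms(2) this]
  have F: "numbered ?F n ps" using assms(3) by (simp add: n_def shift_def)
  then obtain h where h: "bij_betw h (verts ?F) {..<n}" "edges ?F \<subseteq> Pow (verts ?F)"
    "(`) h ` edges ?F = (\<lambda>(i, j). {i, j}) ` set ps" by (auto simp: numbered_def)
  obtain vs where vs: "distinct vs" "set vs = verts H"
    "edges H \<subseteq> (\<lambda>(i, j). {vs ! i, vs ! j}) ` set ps"
    using assms(4) by (auto simp: fits_def)
  have len: "length vs = n" using distinct_card[OF vs(1)] vs(2) by (simp add: n_def order_def)
  have vsbij: "bij_betw ((!) vs) {..<n} (verts H)" using bij_betw_nth[OF vs(1), of "{..<n}"] len vs(2) by simp
  define f where "f = inv_into (verts ?F) h \<circ> inv_into {..<n} ((!) vs)"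
  have f: "bij_betw f (verts H) (verts ?F)"
    unfolding f_def by (rule bij_betw_trans[OF bij_betw_inv_into[OF vsbij] bij_betw_inv_into[OF h(1)]])
  have f_nth: "f (vs ! h x) = x" if "x \<in> verts ?F" for x
  proof -
    have "h x \<in> {..<n}" using h(1) that by (auto simp: bij_betw_def)
    then show ?thesis
      using bij_betw_inv_into_left[OF vsbij] bij_betw_inv_into_left[OF h(1) that] by (simp add: f_def)
  qed
  \<comment> \<open>All vertices of the padded graph are kept, isolated ones included, so that
    \<open>f\<close> is a bijection onto them.\<close>
  define H' where "H' = \<lparr>verts = verts ?F, edges = (`) f ` edges H\<rparr>"
  have "edges H' \<subseteq> edges ?F"
  proof
    fix e' assume "e' \<in> edges H'"
    then obtain e where e: "e \<in> edges H" "e' = f ` e" by (auto simp: H'_def)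
    then obtain i j where ij: "(i, j) \<in> set ps" "e = {vs ! i, vs ! j}" using vs(3) by auto
    then have "{i, j} \<in> (`) h ` edges ?F" using h(3) by force
    then obtain d where d: "d \<in> edges ?F" "{i, j} = h ` d" by auto
    have "e = (!) vs ` h ` d" using ij(2) by (simp flip: d(2))
    then have "e' = (\<lambda>x. f (vs ! h x)) ` d" using e(2) by (simp add: image_image)
    also have "\<dots> = d" using f_nth d(1) h(2) by force
    finally show "e' \<in> edges ?F" using d(1) by simp
  qed
  moreover have "simple_graph H'"
  proof -
    have "finite (verts ?F)" using numbered_order[OF F] by simp
    moreover have "\<exists>u v. e = {u, v} \<and> u \<in> verts ?F \<and> v \<in> verts ?F \<and> u \<noteq> v"
      if e: "e \<in> edges H'" for e
    proof -
      obtain d where d: "d \<in> edges H" "e = f ` d" using e by (auto simp: H'_def)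
      obtain u v where uv: "d = {u, v}" "u \<in> verts H" "v \<in> verts H" "u \<noteq> v"
        using assms(1) d(1) by (rule edge_of_simple_graph)
      have "e = {f u, f v}" "f u \<in> verts ?F" "f v \<in> verts ?F" "f u \<noteq> f v"
        using uv d(2) f by (auto simp: bij_betw_def inj_on_def)
      then show ?thesis by blast
    qed
    ultimately show ?thesis by (auto simp: simple_graph_def H'_def)
  qed
  ultimately have "subgraph H' ?F" by (simp add: subgraph_def H'_def)
  moreover have "isomorphic H H'" using f by (auto simp: isomorphic_def H'_def)
  ultimately show ?thesis
    using numbered_order[OF assms(2)] unfolding is_subgraph_of_def n_def by auto
qed

lemma is_subgraph_of_iff_fits:
  assumes "simple_graph H" "numbered F m ps" "m \<le> order H"
  shows "is_subgraph_of H F \<longleftrightarrow> fits H ps"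
  using is_subgraph_of_imp_fits[OF assms] fits_imp_is_subgraph_of[OF assms] by blast

section \<open>Partitions of the order into component orders\<close>

text \<open>The partitions of \<open>n\<close> into parts of size at most \<open>m\<close>, written
  as weakly decreasing lists.\<close>

fun parts :: "nat \<Rightarrow> nat \<Rightarrow> nat list list" where
  "parts 0 n = (if n = 0 then [[]] else [])"
| "parts (Suc m) n = (if Suc m \<le> n then map ((#) (Suc m)) (parts (Suc m) (n - Suc m)) else []) @ parts m n"

declare parts.simps(2) [simp del]

lemma in_parts:
  assumes "sorted_wrt (\<ge>) ls" "\<forall>l\<in>set ls. 0 < l \<and> l \<le> m" "sum_list ls = n"
  shows "ls \<in> set (parts m n)"
  using assms
proof (induction m n arbitrary: ls rule: parts.induct)
  case (1 n)
  then have "ls = []" by (cases ls) auto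
  then show ?case using 1 by simp
next
  case (2 m n)
  show ?case
  proof (cases "\<exists>xs. ls = Suc m # xs")
    case True
    then obtain xs where xs: "ls = Suc m # xs" ..
    then have "xs \<in> set (parts (Suc m) (n - Suc m))" using "2.prems" by (intro "2.IH"(1)) auto
    then show ?thesis using xs "2.prems"(3) by (auto simp: parts.simps(2)[of m n])
  next
    case False
    have "l \<le> m" if "l \<in> set ls" for l
    proof (cases ls)
      case (Cons x xs)
      then have "l \<le> x" "x \<noteq> Suc m" "x \<le> Suc m" using "2.prems" False that by auto
      then show ?thesis by simp
    qed (use that in simp)
    then have "ls \<in> set (parts m n)" using "2.prems" by (intro "2.IH"(2)) auto
    then show ?thesis by (simp add: parts.simps(2)[of m n])
  qed
qed

text \<open>The pieces of an entry stay in its place, so that in a layout they occupy exactly the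
  positions of that entry's block.\<close>

fun refinements :: "nat list \<Rightarrow> nat list list" where
  "refinements [] = [[]]"
| "refinements (b # bs) = concat (map (\<lambda>p. map ((@) p) (refinements bs)) (parts b b))"

text \<open>Components of orders \<open>ls\<close> can be distributed over the components of orders \<open>bs\<close> of the target.\<close>

definition packs :: "nat list \<Rightarrow> nat list \<Rightarrow> (nat list \<times> nat list) \<Rightarrow> bool" where
  "packs cs ls = (\<lambda>(ct, bs). \<exists>ls'\<in>set (refinements bs). sort ls' = sort ls \<and>
     set (layout cs 0 ls') \<subseteq> set (layout ct 0 bs))"

abbreviation (input) small_pairs :: "nat \<Rightarrow> nat \<Rightarrow> bool" where
  "small_pairs a b \<equiv> 4 \<le> a \<longrightarrow> b \<le> 2"

lemma packs_5: "\<forall>ls\<in>set (parts 5 5). \<exists>t\<in>set [([], [5]), ([3], [2, 3])]. packs [3] ls t"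
  by code_simp

lemma packs_6: "\<forall>ls\<in>set (parts 6 6). \<exists>t\<in>set [([6], [6]), ([3], [3, 3])]. packs [3, 6] ls t"
  by code_simp

text \<open>The bound 6 and the pair condition encode the exclusion of a P4 disjoint from a P3; at
  order 7 they remove just the partitions 7 and 4, 3.\<close>

lemma packs_7: "\<forall>ls\<in>set (parts 6 7). sorted_wrt small_pairs ls \<longrightarrow>
    (\<exists>t\<in>set [([6], [6, 1]), ([3], [2, 2, 3]), ([], [5, 2]), ([3], [3, 3, 1])]. packs [3, 6] ls t)"
  by code_simp

text \<open>From order 8 on a six-cycle is excluded, hence \<open>[3]\<close> in place of
  \<open>[3, 6]\<close>.\<close>

lemma packs_8: "\<forall>ls\<in>set (parts 6 8). sorted_wrt small_pairs ls \<longrightarrow>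
    (\<exists>t\<in>set [([3], [2, 3, 3]), ([], [6, 2])]. packs [3] ls t)"
  by code_simp

text \<open>If the 3 is read as a triangle, the partition 3, 2, 2, 2 fits neither target.\<close>

lemma packs_9: "\<forall>ls\<in>set (parts 3 9). ls \<noteq> [3, 2, 2, 2] \<longrightarrow>
    (\<exists>t\<in>set [([3], [3, 3, 3]), ([], [3, 2, 2, 2])]. packs [3] ls t)"
  by code_simp

text \<open>The case without cycles: with \<open>cs\<close> empty, 3, 2, 2, 2 is the second target
  itself.\<close>

lemma packs_9_paths: "\<forall>ls\<in>set (parts 3 9).
    (\<exists>t\<in>set [([3], [3, 3, 3]), ([], [3, 2, 2, 2])]. packs [] ls t)"
  by code_simp

section \<open>Explicit colorings\<close>

text \<open>The edges \<open>wx\<close>, \<open>xy\<close>, \<open>bz\<close> form a path for \<open>b = y\<close> and a star with center \<open>x\<close> for \<open>b = x\<close>.\<close>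

definition spans :: "('a \<Rightarrow> 'a \<Rightarrow> nat) \<Rightarrow> 'a set \<Rightarrow> bool" where
  "spans L S \<longleftrightarrow> (\<exists>w x y z b. S = {w, x, y, z} \<and> distinct [w, x, y, z] \<and> b \<in> {x, y} \<and>
     {L w x, L x y, L b z} = {1, 2, 3})"

lemma rainbow_tree_of_spans:
  assumes "simple_graph G" "spans L S" "S \<subseteq> verts G"
    and L: "\<And>u v. u \<in> S \<Longrightarrow> v \<in> S \<Longrightarrow> u \<noteq> v \<Longrightarrow> L u v \<noteq> 0 \<Longrightarrow> {u, v} \<in> edges G \<and> c {u, v} = L u v"
  shows "\<exists>T. rainbow_tree G c S T"
proof -
  obtain w x y z b where S: "S = {w, x, y, z}" "distinct [w, x, y, z]" "b \<in> {x, y}"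
    and col: "{L w x, L x y, L b z} = {1, 2, 3}"
    using assms(2) unfolding spans_def by blast
  \<comment> \<open>Grown from \<open>w\<close> by the leaves \<open>x\<close>, \<open>y\<close>,
    \<open>z\<close> in turn; the choice of \<open>b\<close> decides between a path and a
    star.\<close>
  define T where "T = \<lparr>verts = {z, y, x, w}, edges = {{b, z}, {x, y}, {w, x}}\<rparr>"
  have "tree \<lparr>verts = {x, w}, edges = {{w, x}}\<rparr>"
    using tree_add_leaf[OF tree_singleton, of w w x] S(2) by auto
  from tree_add_leaf[OF this, of x y] have "tree \<lparr>verts = {y, x, w}, edges = {{x, y}, {w, x}}\<rparr>"
    using S(2) by auto
  from tree_add_leaf[OF this, of b z] have T: "tree T" using S(2,3) by (auto simp: T_def)
  have "L w x \<in> {1, 2, 3}" "L x y \<in> {1, 2, 3}" "L b z \<in> {1, 2, 3}"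
    unfolding col[symmetric] by auto
  then have "L w x \<noteq> 0" "L x y \<noteq> 0" "L b z \<noteq> 0" by auto
  moreover have "b \<in> S" "b \<noteq> z" using S by auto
  ultimately have e: "{w, x} \<in> edges G \<and> c {w, x} = L w x" "{x, y} \<in> edges G \<and> c {x, y} = L x y"
    "{b, z} \<in> edges G \<and> c {b, z} = L b z"
    using L S(1,2) by auto
  have "c ` edges T = {L b z, L x y, L w x}" using e by (simp add: T_def)
  also have "\<dots> = {1, 2, 3}" using col by (simp add: insert_commute)
  finally have "card (c ` edges T) = 3" by simp
  moreover have "card (edges T) \<le> 3" by (auto simp: T_def card_insert_if)
  moreover have fin: "finite (edges T)" by (simp add: T_def)
  ultimately have "card (c ` edges T) = card (edges T)" using card_image_le[OF fin, of c] by simp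
  then have "inj_on c (edges T)" using fin by (simp add: eq_card_imp_inj_on)
  moreover have "subgraph T G" using T S(1) e assms(3) by (auto simp: subgraph_def tree_def T_def)
  ultimately have "rainbow_tree G c S T" using T S(1) by (auto simp: rainbow_tree_def T_def)
  then show ?thesis by blast
qed

text \<open>Only injectivity of \<open>g\<close> and one implication from labels to edges are asked
  for. So a table also serves induced subgraphs of its graph and graphs with additional
  edges.\<close>

lemma rainbow_coloring_of_labels:
  assumes "simple_graph G" "inj_on g (verts G)"
    and sym: "\<And>i j. L i j = L j i"
    and edge: "\<And>u v. u \<in> verts G \<Longrightarrow> v \<in> verts G \<Longrightarrow> u \<noteq> v \<Longrightarrow> L (g u) (g v) \<noteq> 0 \<Longrightarrow> {u, v} \<in> edges G"
    and range: "\<And>u v. u \<in> verts G \<Longrightarrow> v \<in> verts G \<Longrightarrow> u \<noteq> v \<Longrightarrow> L (g u) (g v) \<le> 3"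
    and spans: "\<And>S. S \<subseteq> g ` verts G \<Longrightarrow> card S = 4 \<Longrightarrow> spans L S"
  shows "\<exists>c. rainbow_coloring 4 G 3 c"
proof -
  \<comment> \<open>The choice picks one of the two orientations of an edge, which agree by symmetry
    of \<open>L\<close>. The maximum gives color 1 to an edge that the table marks as
    missing.\<close>
  define c where "c e = max 1 (SOME q. \<exists>u v. e = {u, v} \<and> q = L (g u) (g v))" for e
  have c: "c {u, v} = max 1 (L (g u) (g v))" for u v
  proof -
    have "(SOME q. \<exists>u' v'. {u, v} = {u', v'} \<and> q = L (g u') (g v')) = L (g u) (g v)"
    proof (rule some_equality)
      fix q assume "\<exists>u' v'. {u, v} = {u', v'} \<and> q = L (g u') (g v')"
      then show "q = L (g u) (g v)" using sym by (auto simp: doubleton_eq_iff)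
    qed blast
    then show ?thesis by (simp add: c_def)
  qed
  have "c ` edges G \<subseteq> {1..3}"
  proof
    fix q assume "q \<in> c ` edges G"
    then obtain e where e: "e \<in> edges G" "q = c e" by blast
    obtain u v where "e = {u, v}" "u \<in> verts G" "v \<in> verts G" "u \<noteq> v"
      using assms(1) e(1) by (rule edge_of_simple_graph)
    then show "q \<in> {1..3}" using e(2) c range by simp
  qed
  moreover have "\<exists>T. rainbow_tree G c S T" if S: "S \<subseteq> verts G" "card S = 4" for S
  proof (rule rainbow_tree_of_spans[OF assms(1) _ S(1)])
    have inj: "inj_on g S" using assms(2) S(1) by (rule inj_on_subset)
    have "spans L (g ` S)" using spans[of "g ` S"] S card_image[OF inj] by auto
    then obtain w x y z b where q: "g ` S = {w, x, y, z}" "distinct [w, x, y, z]" "b \<in> {x, y}"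
      "{L w x, L x y, L b z} = {1, 2, 3}"
      unfolding spans_def by blast
    define h where "h = inv_into S g"
    have h: "h i \<in> S \<and> g (h i) = i" if "i \<in> {w, x, y, z}" for i
      using that q(1) by (metis f_inv_into_f h_def inv_into_into)
    have "S = h ` g ` S" using inj by (simp add: h_def inv_into_image_cancel)
    then have "S = {h w, h x, h y, h z}" using q(1) by simp
    moreover have "distinct [h w, h x, h y, h z]" using q(2) h by (simp, metis)
    moreover have "h b \<in> {h x, h y}" using q(3) by auto
    moreover have "b \<in> {w, x, y, z}" using q(3) by auto
    then have "{L (g (h w)) (g (h x)), L (g (h x)) (g (h y)), L (g (h b)) (g (h z))} = {1, 2, 3}"
      using q(4) h by simp
    ultimately show "spans (\<lambda>u v. L (g u) (g v)) S" unfolding spans_def by blast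
  next
    show "{u, v} \<in> edges G \<and> c {u, v} = L (g u) (g v)"
      if "u \<in> S" "v \<in> S" "u \<noteq> v" "L (g u) (g v) \<noteq> 0" for u v
      using edge[of u v] that S(1) c[of u v] by auto
  qed
  ultimately show ?thesis unfolding rainbow_coloring_def by blast
qed

section \<open>Colorings given by tables\<close>

definition label :: "nat list list \<Rightarrow> nat \<Rightarrow> nat \<Rightarrow> nat" where
  "label t i j = t ! max i j ! min i j"

text \<open>The nested conditionals make \<open>code_simp\<close> evaluate lazily.\<close>

definition rainbow3 :: "nat \<Rightarrow> nat \<Rightarrow> nat \<Rightarrow> bool" where
  "rainbow3 p q r = (if p = 0 then False else if q = 0 then False else if r = 0 then False
     else if p = q then False else if p = r then False else q \<noteq> r)"

fun some_rainbow3 :: "(nat \<times> nat \<times> nat) list \<Rightarrow> bool" where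
  "some_rainbow3 [] = False"
| "some_rainbow3 ((p, q, r) # ts) = (if rainbow3 p q r then True else some_rainbow3 ts)"

text \<open>The list runs through the sixteen spanning trees of the complete graph on \<open>a, b, c, d\<close>.\<close>

definition quad_ok :: "nat \<Rightarrow> nat \<Rightarrow> nat \<Rightarrow> nat \<Rightarrow> nat \<Rightarrow> nat \<Rightarrow> bool" where
  "quad_ok ab ac ad bc bd cd = some_rainbow3
     [(ab, bc, cd), (ab, bd, cd), (ac, bc, bd), (ac, cd, bd), (ad, bd, bc), (ad, cd, bc),
      (ab, ac, cd), (ab, ad, cd), (ac, ab, bd), (ac, ad, bd), (ad, ab, bc), (ad, ac, bc),
      (ab, ac, ad), (ab, bc, bd), (ac, bc, cd), (ad, bd, cd)]"

definition rainbow_table :: "nat list list \<Rightarrow> bool" where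
  "rainbow_table t \<longleftrightarrow>
     (\<forall>l\<in>set [0..<length t]. \<forall>k\<in>set [0..<l]. \<forall>j\<in>set [0..<k]. \<forall>i\<in>set [0..<j].
        quad_ok (t ! j ! i) (t ! k ! i) (t ! l ! i) (t ! k ! j) (t ! l ! j) (t ! l ! k)) \<and>
     (\<forall>i\<in>set [0..<length t]. \<forall>j\<in>set [0..<i]. t ! i ! j \<le> 3)"

text \<open>Row \<open>i\<close> of a table lists the colors of the pairs \<open>{i, j}\<close> with \<open>j < i\<close>, where 0 marks a missing
  edge. For \<open>3K\<^sub>3\<close> the vertex \<open>3a + b\<close> is the point \<open>(a, b)\<close> of the affine plane of order 3, and the
  color of a pair is determined by the slope of the line through it, the vertical lines being
  omitted.\<close>

definition table_K3_K3_K3 :: "nat list list" where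
  "table_K3_K3_K3 = [[], [0], [0, 0], [1, 3, 2], [2, 1, 3, 0], [3, 2, 1, 0, 0], [1, 2, 3, 1, 3, 2],
     [3, 1, 2, 2, 1, 3, 0], [2, 3, 1, 3, 2, 1, 0, 0]]"

definition table_P3_K2_K2_K2 :: "nat list list" where
  "table_P3_K2_K2_K2 = [[], [0], [3, 0], [2, 1, 3], [3, 2, 1, 0], [2, 3, 1, 2, 1], [1, 3, 2, 3, 3, 0],
     [3, 1, 2, 1, 3, 3, 2], [1, 2, 3, 3, 2, 3, 1, 0]]"

definition table_P6_K2 :: "nat list list" where
  "table_P6_K2 = [[], [0], [3, 0], [1, 2, 0], [2, 3, 1, 0], [3, 1, 2, 3, 0], [1, 3, 2, 1, 3, 2],
     [2, 1, 3, 3, 2, 1, 0]]"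

text \<open>Vertex 6 has no missing pair: the table is for a six-cycle with one isolated vertex, and
  its restriction to the vertices 0 to 5 serves order 6.\<close>

definition table_C6 :: "nat list list" where
  "table_C6 = [[], [0], [3, 0], [2, 1, 0], [1, 3, 2, 0], [0, 2, 1, 3, 0], [2, 3, 1, 2, 3, 1]]"

lemma rainbow_tables:
  "rainbow_table table_K3_K3_K3" "rainbow_table table_P3_K2_K2_K2"
  "rainbow_table table_P6_K2" "rainbow_table table_C6"
  by code_simp+

lemma label_sym: "label t i j = label t j i"
  by (simp add: label_def max.commute min.commute)

lemma spans_of_quad_ok:
  assumes "distinct [a, b, c, d]" and sym: "\<And>u v. L u v = L v u"
    and range: "\<And>u v. u \<in> {a, b, c, d} \<Longrightarrow> v \<in> {a, b, c, d} \<Longrightarrow> u \<noteq> v \<Longrightarrow> L u v \<le> 3"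
    and "quad_ok (L a b) (L a c) (L a d) (L b c) (L b d) (L c d)"
  shows "spans L {a, b, c, d}"
proof (rule ccontr)
  assume no: "\<not> ?thesis"
  have I: "\<not> rainbow3 (L w x) (L x y) (L e z)"
    if "{w, x, y, z} = {a, b, c, d}" "distinct [w, x, y, z]" "e \<in> {x, y}" for w x y z e
  proof
    assume r: "rainbow3 (L w x) (L x y) (L e z)"
    have mem: "w \<in> {a, b, c, d}" "x \<in> {a, b, c, d}" "y \<in> {a, b, c, d}" "z \<in> {a, b, c, d}"
      "e \<in> {a, b, c, d}" using that unfolding that(1)[symmetric] by auto
    have "e \<noteq> z" using that(2,3) by auto
    then have "L w x \<le> 3" "L x y \<le> 3" "L e z \<le> 3"
      using range mem that(2) by auto
    then have "{L w x, L x y, L e z} \<subseteq> {1, 2, 3}" "card {L w x, L x y, L e z} = 3"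
      using r by (auto simp: rainbow3_def split: if_splits)
    then have "{L w x, L x y, L e z} = {1, 2, 3}" using card_subset_eq[of "{1, 2, 3::nat}"] by simp
    then have "spans L {w, x, y, z}" using that unfolding spans_def by blast
    then show False using no that(1) by simp
  qed
  show False
    \<comment> \<open>The instances follow the list in \<open>quad_ok\<close>: twelve paths with
      \<open>e = y\<close>, then four stars with \<open>e = x\<close>.\<close>
    using assms(1,4) I[of a b c d c] I[of a b d c d] I[of a c b d b] I[of a c d b d]
      I[of a d b c b] I[of a d c b c] I[of b a c d c] I[of b a d c d] I[of c a b d b]
      I[of c a d b d] I[of d a b c b] I[of d a c b c] I[of b a c d a] I[of a b c d b]
      I[of a c b d c] I[of a d b c d]
    by (auto simp: quad_ok_def sym[of b a] sym[of c a] sym[of d a] sym[of c b] sym[of d b] sym[of d c]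
        insert_commute)
qed

lemma label_le_3:
  assumes "rainbow_table t" "i < length t" "j < length t" "i \<noteq> j"
  shows "label t i j \<le> 3"
  using assms unfolding rainbow_table_def label_def by (cases "i < j") auto

lemma spans_of_rainbow_table:
  assumes "rainbow_table t" "S \<subseteq> {..<length t}" "card S = 4"
  shows "spans (label t) S"
proof -
  have fin: "finite S" using assms(3) by (metis card.infinite zero_neq_numeral)
  \<comment> \<open>A table is tested on increasing quadruples only, so \<open>S\<close> is listed
    in increasing order.\<close>
  have "length (sorted_list_of_set S) = 4" by (simp only: length_sorted_list_of_set assms(3))
  then obtain i j k l where ijkl: "sorted_list_of_set S = [i, j, k, l]"
    by (auto simp only: numeral_eq_Suc pred_numeral_simps BitM.simps length_Suc_conv length_0_conv)
  have "S = set [i, j, k, l]" using fin by (simp flip: ijkl)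
  then have S: "S = {i, j, k, l}" by simp
  have "sorted_wrt (<) [i, j, k, l]" unfolding ijkl[symmetric] by simp
  then have less: "i < j" "j < k" "k < l" by auto
  have "l < length t" using assms(2) S by auto
  then have "quad_ok (t ! j ! i) (t ! k ! i) (t ! l ! i) (t ! k ! j) (t ! l ! j) (t ! l ! k)"
    using assms(1) less unfolding rainbow_table_def by simp
  then have "quad_ok (label t i j) (label t i k) (label t i l) (label t j k) (label t j l) (label t k l)"
    using less by (simp add: label_def)
  moreover have "label t u v \<le> 3" if "u \<in> {i, j, k, l}" "v \<in> {i, j, k, l}" "u \<noteq> v" for u v
    using that S assms(2) by (intro label_le_3[OF assms(1)]) auto
  ultimately show ?thesis
    unfolding S using less by (intro spans_of_quad_ok) (auto simp: label_sym)
qed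

text \<open>The list \<open>js\<close> places the positions of the target at vertices of the table.
  Every pair of \<open>ps\<close> lands on a missing pair, so a nonzero label can only belong to an
  edge of \<open>G\<close>.\<close>

lemma rainbow_coloring_of_fits:
  assumes "simple_graph G" "fits (complement G) ps" "order G = length js"
    and "rainbow_table t" "distinct js" "set js \<subseteq> {..<length t}"
    and "\<forall>(i, j)\<in>set ps. i < length js \<and> j < length js \<and> label t (js ! i) (js ! j) = 0"
  shows "\<exists>c. rainbow_coloring 4 G 3 c"
proof -
  obtain vs where vs: "distinct vs" "set vs = verts G"
    "edges (complement G) \<subseteq> (\<lambda>(i, j). {vs ! i, vs ! j}) ` set ps"
    using assms(2) by (auto simp: fits_def complement_def)
  have len: "length vs = length js"
    using distinct_card[OF vs(1)] vs(2) assms(3) by (simp add: order_def)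
  have vsbij: "bij_betw ((!) vs) {..<length js} (verts G)"
    using bij_betw_nth[OF vs(1), of "{..<length js}"] len vs(2) by simp
  define idx where "idx = inv_into {..<length js} ((!) vs)"
  have idx: "bij_betw idx (verts G) {..<length js}"
    unfolding idx_def by (rule bij_betw_inv_into[OF vsbij])
  have jsbij: "bij_betw ((!) js) {..<length js} (set js)"
    using bij_betw_nth[OF assms(5)] by simp
  have g: "bij_betw ((!) js \<circ> idx) (verts G) (set js)" by (rule bij_betw_trans[OF idx jsbij])
  define h where "h = (!) js \<circ> idx"
  have h: "inj_on h (verts G)" "h ` verts G = set js"
    using g by (auto simp: h_def bij_betw_def)
  show ?thesis
  proof (rule rainbow_coloring_of_labels[of G h "label t"])
    show "label t i j = label t j i" for i j by (rule label_sym)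
  next
    fix u v
    assume uv: "u \<in> verts G" "v \<in> verts G" "u \<noteq> v"
    have "h u < length t" "h v < length t" "h u \<noteq> h v"
      using uv h assms(6) by (auto simp: inj_on_def)
    then show "label t (h u) (h v) \<le> 3"
      using label_le_3[OF assms(4)] by simp
    assume nz: "label t (h u) (h v) \<noteq> 0"
    show "{u, v} \<in> edges G"
    proof (rule ccontr)
      assume "{u, v} \<notin> edges G"
      then have "{u, v} \<in> edges (complement G)" using uv by (auto simp: complement_def)
      then obtain i j where ij: "(i, j) \<in> set ps" "{u, v} = {vs ! i, vs ! j}" using vs(3) by auto
      have lt: "i < length js" "j < length js" "label t (js ! i) (js ! j) = 0"
        using ij(1) assms(7) by auto
      then have "h (vs ! i) = js ! i" "h (vs ! j) = js ! j"
        using bij_betw_inv_into_left[OF vsbij] by (auto simp: h_def idx_def)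
      moreover have "label t (js ! j) (js ! i) = 0"
        using lt(3) by (simp add: label_sym)
      ultimately show False using ij(2) lt(3) nz by (auto simp: doubleton_eq_iff)
    qed
  next
    show "spans (label t) S" if "S \<subseteq> h ` verts G" "card S = 4" for S
      using spans_of_rainbow_table[OF assms(4) _ that(2)] that(1) assms(6) h(2) by auto
  qed (use assms(1) h(1) in simp_all)
qed

section \<open>The classification\<close>

lemma simple_graph_complement:
  assumes "simple_graph G"
  shows "simple_graph (complement G)"
  using assms by (auto simp: simple_graph_def complement_def)

lemma edge_in_complement:
  assumes "{u, v} \<in> edges (complement G)"
  shows "u \<in> verts G" "v \<in> verts G" "u \<noteq> v" "{u, v} \<notin> edges G"
  using assms by (auto simp: complement_def doubleton_eq_iff insert_commute)

lemma order_complement: "order (complement G) = order G"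
  by (simp add: order_def complement_def)

section \<open>Component orders that a rainbow coloring permits\<close>

context rainbow_colored
begin

lemma max_degree_2_complement: "max_degree_2 (complement G)"
  unfolding max_degree_2_def
proof (intro allI impI, rule ccontr)
  fix v x y z
  assume e: "{v, x} \<in> edges (complement G) \<and> {v, y} \<in> edges (complement G) \<and> {v, z} \<in> edges (complement G)"
    and ne: "\<not> (x = y \<or> x = z \<or> y = z)"
  note x = edge_in_complement[of v x G] and y = edge_in_complement[of v y G]
    and z = edge_in_complement[of v z G]
  have "distinct [v, x, y, z]" using e ne x(3) y(3) z(3) by simp
  moreover have "{v, x, y, z} \<subseteq> verts G" using e x(1,2) y(2) z(2) by simp
  ultimately show False using no_omitted_star e x(4) y(4) z(4) by blast
qed

text \<open>Decreasing order of the lengths is the form in which \<open>parts\<close> enumerates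
  partitions.\<close>

lemma obtain_components:
  obtains pss ls where "component_paths (complement G) pss" "ls = map length pss"
    "sorted_wrt (\<ge>) ls" "sum_list ls = order G" "\<forall>l\<in>set ls. 0 < l"
proof -
  obtain pss where pss: "component_paths (complement G) pss"
    using component_paths_exist[OF simple_graph_complement[OF simple] max_degree_2_complement] ..
  define ls where "ls = rev (sort (map length pss))"
  have "mset ls = mset (map length pss)" by (simp add: ls_def)
  then obtain qss where qss: "component_paths (complement G) qss" "map length qss = ls"
    using component_paths_reorder[OF pss] by metis
  have "sorted_wrt (\<ge>) ls" by (simp add: ls_def sorted_wrt_rev)
  moreover have "distinct (concat qss)" using qss(1) by (simp add: component_paths_def)
  then have "sum_list ls = card (set (concat qss))"
    unfolding qss(2)[symmetric] length_concat[symmetric] by (rule distinct_card[symmetric])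
  then have "sum_list ls = order G"
    using qss(1) by (simp add: component_paths_def order_def complement_def)
  moreover have "\<forall>l\<in>set ls. 0 < l"
    using qss(1) by (auto simp: component_paths_def simp flip: qss(2))
  ultimately show thesis using that[OF qss(1)] qss(2) by simp
qed

lemma component_path:
  assumes "component_paths (complement G) pss" "p \<in> set pss"
  shows "distinct p" "set p \<subseteq> verts G" "Suc i < length p \<Longrightarrow> {p ! i, p ! Suc i} \<notin> edges G"
proof -
  have c: "distinct (concat pss)" "set (concat pss) = verts G" "path_edges p \<subseteq> edges (complement G)"
    using assms by (auto simp: component_paths_def complement_def)
  show "distinct p" using c(1) assms(2) by (simp add: distinct_concat_iff)
  show "set p \<subseteq> verts G" using c(2) assms(2) by auto
  show "{p ! i, p ! Suc i} \<notin> edges G" if "Suc i < length p"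
  proof -
    have "{p ! i, p ! Suc i} \<in> edges (complement G)" using that c(3) by (auto simp: path_edges_def)
    then show ?thesis by (rule edge_in_complement(4))
  qed
qed

lemma component_paths_disjoint:
  assumes "component_paths (complement G) pss" "i < j" "j < length pss"
  shows "set (pss ! i) \<inter> set (pss ! j) = {}"
proof -
  have "distinct (concat pss)" "[] \<notin> set pss" using assms(1) by (auto simp: component_paths_def)
  \<comment> \<open>\<open>distinct_concat_iff\<close> gives distinctness after the empty lists are
    removed; here there are none.\<close>
  then have "removeAll [] pss = pss" by simp
  then have "distinct pss" using \<open>distinct (concat pss)\<close> by (metis distinct_concat_iff)
  then have "pss ! i \<noteq> pss ! j" using assms(2,3) by (simp add: nth_eq_iff_index_eq)
  then show ?thesis
    using \<open>distinct (concat pss)\<close> assms(2,3) by (auto simp: distinct_concat_iff)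
qed

text \<open>Seven consecutive vertices of a path split into a P4 and a P3.\<close>

lemma component_length_le_6:
  assumes "component_paths (complement G) pss" "p \<in> set pss"
  shows "length p \<le> 6"
proof (rule ccontr)
  assume long: "\<not> ?thesis"
  note p = component_path[OF assms]
  have "set (take 7 p) \<subseteq> verts G" using p(2) set_take_subset[of 7 p] by blast
  moreover have "omits (take 7 p) [(0, 1), (1, 2), (2, 3), (4, 5), (5, 6)]"
    using p(3)[of 0] p(3)[of 1] p(3)[of 2] p(3)[of 4] p(3)[of 5] long
    by (simp add: omits_def numeral_eq_Suc)
  ultimately show False using no_omitted_P4_P3[of "take 7 p"] p(1) long by simp
qed

lemma component_lengths_small_pair:
  assumes "component_paths (complement G) pss" "i < j" "j < length pss" "4 \<le> length (pss ! i)"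
  shows "length (pss ! j) \<le> 2"
proof (rule ccontr)
  assume long: "\<not> ?thesis"
  let ?p = "pss ! i" and ?q = "pss ! j"
  have mem: "?p \<in> set pss" "?q \<in> set pss" using assms(2,3) by auto
  note p = component_path[OF assms(1) mem(1)] and q = component_path[OF assms(1) mem(2)]
  let ?vs = "take 4 ?p @ take 3 ?q"
  have "set (take 4 ?p) \<inter> set (take 3 ?q) = {}"
    using component_paths_disjoint[OF assms(1-3)] set_take_subset[of 4 ?p] set_take_subset[of 3 ?q]
    by blast
  then have "distinct ?vs" using p(1) q(1) by simp
  moreover have "set ?vs \<subseteq> verts G"
    using p(2) q(2) set_take_subset[of 4 ?p] set_take_subset[of 3 ?q] by auto
  moreover have "omits ?vs [(0, 1), (1, 2), (2, 3), (4, 5), (5, 6)]"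
    using p(3)[of 0] p(3)[of 1] p(3)[of 2] q(3)[of 0] q(3)[of 1] assms(4) long
    by (simp add: omits_def nth_append numeral_eq_Suc)
  ultimately show False using no_omitted_P4_P3[of ?vs] assms(4) long by simp
qed

lemma component_length_le_3:
  assumes "component_paths (complement G) pss" "p \<in> set pss" "9 \<le> order G"
  shows "length p \<le> 3"
proof (rule ccontr)
  assume long: "\<not> ?thesis"
  note p = component_path[OF assms(1,2)]
  have "distinct (take 4 p)" "set (take 4 p) \<subseteq> verts G" "length (take 4 p) \<le> 9" "9 \<le> card (verts G)"
    using p(1,2) set_take_subset[of 4 p] assms(3) by (auto simp: order_def)
  then obtain ys where ys: "distinct (take 4 p @ ys)" "set (take 4 p @ ys) \<subseteq> verts G"
    "length (take 4 p @ ys) = 9"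
    using extend_distinct_list[OF _ _ finite_verts] by blast
  moreover have "omits (take 4 p @ ys) [(0, 1), (1, 2), (2, 3)]"
    using p(3)[of 0] p(3)[of 1] p(3)[of 2] long
    by (simp add: omits_def nth_append numeral_eq_Suc)
  ultimately show False by (rule no_omitted_P4)
qed

lemma closed_component_length:
  assumes "component_paths (complement G) pss" "p \<in> set pss" "3 \<le> length p"
    "{hd p, last p} \<in> edges (complement G)"
  shows "length p = 3 \<or> length p = 6 \<and> order G \<le> 7"
proof (rule ccontr)
  assume neg: "\<not> ?thesis"
  note p = component_path[OF assms(1,2)]
  have "p \<noteq> []" using assms(3) by auto
  then have closed: "{p ! 0, p ! (length p - 1)} \<notin> edges G"
    using edge_in_complement(4)[OF assms(4)] by (simp add: hd_conv_nth last_conv_nth)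
  consider "length p = 4" | "length p = 5" | "length p = 6" "8 \<le> order G"
    using neg assms(3) component_length_le_6[OF assms(1,2)] by linarith
  then show False
  proof cases
    case 1
    have "omits p [(0, 1), (1, 2), (2, 3), (0, 3)]"
      using p(3)[of 0] p(3)[of 1] p(3)[of 2] closed 1 by (simp add: omits_def numeral_eq_Suc)
    then show False using no_omitted_C4 p(1,2) 1 by blast
  next
    case 2
    have "omits p [(0, 1), (1, 2), (2, 3), (3, 4), (0, 4)]"
      using p(3)[of 0] p(3)[of 1] p(3)[of 2] p(3)[of 3] closed 2
      by (simp add: omits_def numeral_eq_Suc)
    then show False using no_omitted_C5 p(1,2) 2 by blast
  next
    case 3
    obtain ys where ys: "distinct (p @ ys)" "set (p @ ys) \<subseteq> verts G" "length (p @ ys) = 8"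
      using extend_distinct_list[OF p(1,2) finite_verts, of 8] 3 by (auto simp: order_def)
    moreover have "omits (p @ ys) [(0, 1), (1, 2), (2, 3), (3, 4), (4, 5), (0, 5)]"
      using p(3)[of 0] p(3)[of 1] p(3)[of 2] p(3)[of 3] p(3)[of 4] closed 3
      by (simp add: omits_def nth_append numeral_eq_Suc)
    ultimately show False by (rule no_omitted_C6)
  qed
qed

text \<open>The concatenated lists are already in the order of positions used by
  \<open>no_omitted_K3_3K2\<close>.\<close>

lemma no_closed_triangle_3_2_2_2:
  assumes "component_paths (complement G) pss" "map length pss = [3, 2, 2, 2]"
    "p \<in> set pss" "3 \<le> length p" "{hd p, last p} \<in> edges (complement G)"
  shows False
proof -
  obtain q r s t where pss: "pss = [q, r, s, t]" and
    len: "length q = 3" "length r = 2" "length s = 2" "length t = 2"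
    using assms(2) by auto
  then have "p = q" using assms(3,4) by auto
  obtain a b c where q: "q = [a, b, c]" using len(1) by (auto simp: numeral_eq_Suc length_Suc_conv)
  obtain d e where r: "r = [d, e]" using len(2) by (auto simp: numeral_eq_Suc length_Suc_conv)
  obtain f g where s: "s = [f, g]" using len(3) by (auto simp: numeral_eq_Suc length_Suc_conv)
  obtain h i where t: "t = [h, i]" using len(4) by (auto simp: numeral_eq_Suc length_Suc_conv)
  let ?vs = "[a, b, c, d, e, f, g, h, i]"
  have concat: "concat pss = ?vs" by (simp add: pss q r s t)
  have "distinct ?vs" "set ?vs \<subseteq> verts G"
    unfolding concat[symmetric] using assms(1) by (auto simp: component_paths_def complement_def)
  moreover have "{a, c} \<notin> edges G"
    using edge_in_complement(4)[OF assms(5)] \<open>p = q\<close> q by simp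
  then have "omits ?vs [(0, 1), (1, 2), (0, 2), (3, 4), (5, 6), (7, 8)]"
    using component_path(3)[OF assms(1), of q 0] component_path(3)[OF assms(1), of q 1]
      component_path(3)[OF assms(1), of r 0] component_path(3)[OF assms(1), of s 0]
      component_path(3)[OF assms(1), of t 0]
    by (simp add: pss q r s t omits_def)
  ultimately show False by (intro no_omitted_K3_3K2[of ?vs]) simp_all
qed

lemma fits_of_packs:
  assumes "component_paths (complement G) pss" "packs cs (map length pss) (ct, bs)"
    and "\<And>p. p \<in> set pss \<Longrightarrow> 3 \<le> length p \<Longrightarrow> {hd p, last p} \<in> edges (complement G)
      \<Longrightarrow> length p \<in> set cs"
  shows "fits (complement G) (layout ct 0 bs)"
proof -
  obtain ls where ls: "sort ls = sort (map length pss)" "set (layout cs 0 ls) \<subseteq> set (layout ct 0 bs)"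
    using assms(2) by (auto simp: packs_def)
  have "mset ls = mset (map length pss)" using ls(1) by (metis mset_sort)
  then show ?thesis using fits_layout[OF assms(1)] assms(3) ls(2) by blast
qed

lemma fits_of_order:
  shows "order G = 5 \<Longrightarrow> \<exists>(ct, bs)\<in>set [([], [5]), ([3], [2, 3])]. fits (complement G) (layout ct 0 bs)"
    and "order G = 6 \<Longrightarrow> \<exists>(ct, bs)\<in>set [([6], [6]), ([3], [3, 3])]. fits (complement G) (layout ct 0 bs)"
    and "order G = 7 \<Longrightarrow> \<exists>(ct, bs)\<in>set [([6], [6, 1]), ([3], [2, 2, 3]), ([], [5, 2]), ([3], [3, 3, 1])].
      fits (complement G) (layout ct 0 bs)"
    and "order G = 8 \<Longrightarrow> \<exists>(ct, bs)\<in>set [([3], [2, 3, 3]), ([], [6, 2])]. fits (complement G) (layout ct 0 bs)"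
    and "order G = 9 \<Longrightarrow> \<exists>(ct, bs)\<in>set [([3], [3, 3, 3]), ([], [3, 2, 2, 2])]. fits (complement G) (layout ct 0 bs)"
proof -
  obtain pss ls where pss: "component_paths (complement G) pss" "ls = map length pss"
    and ls: "sorted_wrt (\<ge>) ls" "sum_list ls = order G" "\<forall>l\<in>set ls. 0 < l"
    by (rule obtain_components)
  have le: "\<forall>l\<in>set ls. l \<le> order G" using member_le_sum_list[of _ ls] by (simp flip: ls(2))
  have le6: "\<forall>l\<in>set ls. l \<le> 6" using component_length_le_6[OF pss(1)] pss(2) by auto
  have small: "sorted_wrt small_pairs ls"
    using component_lengths_small_pair[OF pss(1)] pss(2) by (auto simp: sorted_wrt_iff_nth_less)
  have fits: "\<exists>(ct, bs)\<in>set ts. fits (complement G) (layout ct 0 bs)"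
    if packs: "\<exists>t\<in>set ts. packs cs ls t"
      and cs: "\<And>p. p \<in> set pss \<Longrightarrow> 3 \<le> length p \<Longrightarrow> {hd p, last p} \<in> edges (complement G)
      \<Longrightarrow> length p \<in> set cs" for ts cs
  proof -
    obtain ct bs where t: "(ct, bs) \<in> set ts" "packs cs (map length pss) (ct, bs)"
      using packs pss(2) by fastforce
    show ?thesis using fits_of_packs[OF pss(1) t(2) cs] t(1) by blast
  qed
  note closed = closed_component_length[OF pss(1)]
  show "\<exists>(ct, bs)\<in>set [([], [5]), ([3], [2, 3])]. fits (complement G) (layout ct 0 bs)"
    if n: "order G = 5"
  proof (rule fits[of _ "[3]"])
    have "ls \<in> set (parts 5 5)" using in_parts[OF ls(1) _ ls(2)] ls(3) le n by simp
    then show "\<exists>t\<in>set [([], [5]), ([3], [2, 3])]. packs [3] ls t" using packs_5 by blast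
    \<comment> \<open>This removes the alternative of a closed component of order 6.\<close>
    have "\<forall>p\<in>set pss. length p \<le> 5" using le n pss(2) by simp
    then show "length p \<in> set [3]"
      if "p \<in> set pss" "3 \<le> length p" "{hd p, last p} \<in> edges (complement G)" for p
      using closed[OF that] that(1) by fastforce
  qed
  show "\<exists>(ct, bs)\<in>set [([6], [6]), ([3], [3, 3])]. fits (complement G) (layout ct 0 bs)"
    if n: "order G = 6"
  proof (rule fits[of _ "[3, 6]"])
    have "ls \<in> set (parts 6 6)" using in_parts[OF ls(1) _ ls(2)] ls(3) le n by simp
    then show "\<exists>t\<in>set [([6], [6]), ([3], [3, 3])]. packs [3, 6] ls t" using packs_6 by blast
  qed (use closed in auto)
  show "\<exists>(ct, bs)\<in>set [([6], [6, 1]), ([3], [2, 2, 3]), ([], [5, 2]), ([3], [3, 3, 1])].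
      fits (complement G) (layout ct 0 bs)"
    if n: "order G = 7"
  proof (rule fits[of _ "[3, 6]"])
    have "ls \<in> set (parts 6 7)" using in_parts[OF ls(1) _ ls(2)] ls(3) le6 n by simp
    then show "\<exists>t\<in>set [([6], [6, 1]), ([3], [2, 2, 3]), ([], [5, 2]), ([3], [3, 3, 1])]. packs [3, 6] ls t"
      using packs_7 small by blast
  qed (use closed in auto)
  show "\<exists>(ct, bs)\<in>set [([3], [2, 3, 3]), ([], [6, 2])]. fits (complement G) (layout ct 0 bs)"
    if n: "order G = 8"
  proof (rule fits[of _ "[3]"])
    have "ls \<in> set (parts 6 8)" using in_parts[OF ls(1) _ ls(2)] ls(3) le6 n by simp
    then show "\<exists>t\<in>set [([3], [2, 3, 3]), ([], [6, 2])]. packs [3] ls t"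
      using packs_8 small by blast
  qed (use closed n in fastforce)
  show "\<exists>(ct, bs)\<in>set [([3], [3, 3, 3]), ([], [3, 2, 2, 2])]. fits (complement G) (layout ct 0 bs)"
    if n: "order G = 9"
  proof -
    have "\<forall>l\<in>set ls. l \<le> 3" using component_length_le_3[OF pss(1)] pss(2) n by auto
    then have parts: "ls \<in> set (parts 3 9)" using in_parts[OF ls(1) _ ls(2)] ls(3) n by simp
    show ?thesis
    \<comment> \<open>A closed component decides whether a 3 counts as a triangle, that is, whether
      \<open>cs\<close> is \<open>[3]\<close> or \<open>[]\<close>.\<close>
    proof (cases "\<exists>p\<in>set pss. 3 \<le> length p \<and> {hd p, last p} \<in> edges (complement G)")
      case True
      then have "ls \<noteq> [3, 2, 2, 2]"
        using no_closed_triangle_3_2_2_2[OF pss(1)] pss(2) by metis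
      then have "\<exists>t\<in>set [([3], [3, 3, 3]), ([], [3, 2, 2, 2])]. packs [3] ls t"
        using packs_9 parts by blast
      then show ?thesis by (rule fits) (use closed n in fastforce)
    next
      case False
      have "\<exists>t\<in>set [([3], [3, 3, 3]), ([], [3, 2, 2, 2])]. packs [] ls t"
        using packs_9_paths parts by blast
      then show ?thesis by (rule fits) (use False in blast)
    qed
  qed
qed

end

section \<open>The target graphs and their places in the tables\<close>

lemma numbered_targets:
  shows "numbered (path_graph 5) 5 (layout [] 0 [5])"
    and "numbered (complete_graph 2 \<uplus> complete_graph 3) 5 (layout [3] 0 [2, 3])"
    and "numbered (cycle_graph 6) 6 (layout [6] 0 [6])"
    and "numbered (copies 2 (complete_graph 3)) 6 (layout [3] 0 [3, 3])"
    and "numbered (copies 2 (complete_graph 2) \<uplus> complete_graph 3) 7 (layout [3] 0 [2, 2, 3])"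
    and "numbered (path_graph 5 \<uplus> complete_graph 2) 7 (layout [] 0 [5, 2])"
    and "numbered (complete_graph 2 \<uplus> copies 2 (complete_graph 3)) 8 (layout [3] 0 [2, 3, 3])"
    and "numbered (path_graph 6 \<uplus> complete_graph 2) 8 (layout [] 0 [6, 2])"
    and "numbered (copies 3 (complete_graph 3)) 9 (layout [3] 0 [3, 3, 3])"
    and "numbered (path_graph 3 \<uplus> copies 3 (complete_graph 2)) 9 (layout [] 0 [3, 2, 2, 2])"
proof -
  note K2 = numbered_complete_graph_2 and K3 = numbered_complete_graph_3
  note eval = block_def shift_def upt_rec numeral_eq_Suc
  show "numbered (path_graph 5) 5 (layout [] 0 [5])" by (rule numbered_path_graph)
  show "numbered (cycle_graph 6) 6 (layout [6] 0 [6])" by (rule numbered_cycle_graph) simp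
  show "numbered (complete_graph 2 \<uplus> complete_graph 3) 5 (layout [3] 0 [2, 3])"
    using numbered_disjoint_union[OF K2 K3] by (simp add: eval)
  show "numbered (copies 2 (complete_graph 3)) 6 (layout [3] 0 [3, 3])"
    using numbered_copies[OF K3, of 2] by (simp add: eval)
  show "numbered (copies 2 (complete_graph 2) \<uplus> complete_graph 3) 7 (layout [3] 0 [2, 2, 3])"
    using numbered_disjoint_union[OF numbered_copies[OF K2, of 2] K3] by (simp add: eval)
  show "numbered (path_graph 5 \<uplus> complete_graph 2) 7 (layout [] 0 [5, 2])"
    using numbered_disjoint_union[OF numbered_path_graph[of 5] K2] by (simp add: eval)
  show "numbered (complete_graph 2 \<uplus> copies 2 (complete_graph 3)) 8 (layout [3] 0 [2, 3, 3])"
    using numbered_disjoint_union[OF K2 numbered_copies[OF K3, of 2]] by (simp add: eval)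
  show "numbered (path_graph 6 \<uplus> complete_graph 2) 8 (layout [] 0 [6, 2])"
    using numbered_disjoint_union[OF numbered_path_graph[of 6] K2] by (simp add: eval)
  show "numbered (copies 3 (complete_graph 3)) 9 (layout [3] 0 [3, 3, 3])"
    using numbered_copies[OF K3, of 3] by (simp add: eval)
  show "numbered (path_graph 3 \<uplus> copies 3 (complete_graph 2)) 9 (layout [] 0 [3, 2, 2, 2])"
    using numbered_disjoint_union[OF numbered_path_graph[of 3] numbered_copies[OF K2, of 3]]
    by (simp add: eval)
qed

definition labels_fit :: "nat list list \<Rightarrow> nat list \<Rightarrow> nat list \<Rightarrow> nat list \<Rightarrow> bool" where
  "labels_fit t js ct bs \<longleftrightarrow> distinct js \<and> list_all (\<lambda>j. j < length t) js \<and>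
     list_all (\<lambda>(i, j). i < length js \<and> j < length js \<and> label t (js ! i) (js ! j) = 0) (layout ct 0 bs)"

text \<open>Smaller targets arise from the four tables by dropping vertices: a K2 is a triangle
  without one vertex, the P5 of order 5 is a six-cycle without one vertex, and the P5 of order 7 is
  the P6 without an end.\<close>

lemma labels_fit:
  "labels_fit table_C6 [0..<5] [] [5]"
  "labels_fit table_K3_K3_K3 [0, 1, 3, 4, 5] [3] [2, 3]"
  "labels_fit table_C6 [0..<6] [6] [6]"
  "labels_fit table_K3_K3_K3 [0..<6] [3] [3, 3]"
  "labels_fit table_C6 [0..<7] [6] [6]"
  "labels_fit table_K3_K3_K3 [0, 1, 3, 4, 6, 7, 8] [3] [2, 2, 3]"
  "labels_fit table_P6_K2 [0, 1, 2, 3, 4, 6, 7] [] [5, 2]"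
  "labels_fit table_K3_K3_K3 [0..<7] [3] [3, 3]"
  "labels_fit table_K3_K3_K3 [0, 1, 3, 4, 5, 6, 7, 8] [3] [2, 3, 3]"
  "labels_fit table_P6_K2 [0..<8] [] [6, 2]"
  "labels_fit table_K3_K3_K3 [0..<9] [3] [3, 3, 3]"
  "labels_fit table_P3_K2_K2_K2 [0..<9] [] [3, 2, 2, 2]"
  by code_simp+

lemma rainbow_coloring_of_labels_fit:
  assumes "simple_graph G" "rainbow_table t" "labels_fit t js ct bs" "order G = length js"
    "fits (complement G) (layout ct 0 bs)"
  shows "\<exists>c. rainbow_coloring 4 G 3 c"
  using assms(3) by (intro rainbow_coloring_of_fits[OF assms(1,5,4,2)])
    (auto simp: labels_fit_def list_all_iff)

theorem theorem2p10:
  fixes G :: "'a sgraph"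
  assumes "simple_graph G" and "connected_graph G" and "order G \<ge> 4"
  shows "rainbow_index 4 G = 3 \<longleftrightarrow>
      (connected_graph G \<and> order G = 4)
    \<or> (order G = 5 \<and>
        (is_subgraph_of (complement G) (path_graph 5)
         \<or> is_subgraph_of (complement G) (complete_graph 2 \<uplus> complete_graph 3)))
    \<or> (order G = 6 \<and>
        (is_subgraph_of (complement G) (cycle_graph 6)
         \<or> is_subgraph_of (complement G) (copies 2 (complete_graph 3))))
    \<or> (order G = 7 \<and>
        (is_subgraph_of (complement G) (cycle_graph 6)
         \<or> is_subgraph_of (complement G) (copies 2 (complete_graph 2) \<uplus> complete_graph 3)
         \<or> is_subgraph_of (complement G) (path_graph 5 \<uplus> complete_graph 2)
         \<or> is_subgraph_of (complement G) (copies 2 (complete_graph 3))))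
    \<or> (order G = 8 \<and>
        (is_subgraph_of (complement G) (complete_graph 2 \<uplus> copies 2 (complete_graph 3))
         \<or> is_subgraph_of (complement G) (path_graph 6 \<uplus> complete_graph 2)))
    \<or> (order G = 9 \<and>
        (is_subgraph_of (complement G) (copies 3 (complete_graph 3))
         \<or> is_subgraph_of (complement G) (path_graph 3 \<uplus> copies 3 (complete_graph 2))))"
proof -
  let ?H = "complement G"
  have H: "simple_graph ?H" using assms(1) by (rule simple_graph_complement)
  \<comment> \<open>The type \<open>'b\<close> stays schematic, because the targets live on numbers,
    sums and products.\<close>
  have iff: "is_subgraph_of ?H F \<longleftrightarrow> fits ?H ps" if "numbered F m ps" "m \<le> order G"
    for F :: "'b sgraph" and m ps
    using is_subgraph_of_iff_fits[OF H that(1)] that(2) by (simp add: order_complement)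
  show ?thesis (is "_ \<longleftrightarrow> ?R")
    unfolding rainbow_index_4_eq_3_iff[OF assms]
  proof
    assume "\<exists>c. rainbow_coloring 4 G 3 c"
    then obtain c where "rainbow_colored G c" using assms(1) by (auto simp: rainbow_colored_def)
    then interpret rainbow_colored G c .
    \<comment> \<open>The packing test at order 7 uses targets of total order 7; the added component
      of order 1 contributes no pair.\<close>
    have "layout [6] 0 [6, 1] = layout [6] 0 [6]" "layout [3] 0 [3, 3, 1] = layout [3] 0 [3, 3]"
      by (simp_all add: block_def)
    note pad = this
    consider "order G = 4" | "order G = 5" | "order G = 6" | "order G = 7" | "order G = 8" | "order G = 9"
      using order_le_9 assms(3) by linarith
    then show ?R
    proof cases
      case 1
      then show ?thesis using assms(2) by simp
    next
      case 2
      then show ?thesis using fits_of_order(1) numbered_targets(1,2)[THEN iff] by auto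
    next
      case 3
      then show ?thesis using fits_of_order(2) numbered_targets(3,4)[THEN iff] by auto
    next
      case 4
      then show ?thesis using fits_of_order(3) numbered_targets(3-6)[THEN iff] pad by auto
    next
      case 5
      then show ?thesis using fits_of_order(4) numbered_targets(7,8)[THEN iff] by auto
    next
      case 6
      then show ?thesis using fits_of_order(5) numbered_targets(9,10)[THEN iff] by auto
    qed
  next
    note colored = rainbow_coloring_of_labels_fit[OF assms(1)]
    assume ?R
    then consider "order G = 4"
      | "order G = 5" "fits ?H (layout [] 0 [5])"
      | "order G = 5" "fits ?H (layout [3] 0 [2, 3])"
      | "order G = 6" "fits ?H (layout [6] 0 [6])"
      | "order G = 6" "fits ?H (layout [3] 0 [3, 3])"
      | "order G = 7" "fits ?H (layout [6] 0 [6])"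
      | "order G = 7" "fits ?H (layout [3] 0 [2, 2, 3])"
      | "order G = 7" "fits ?H (layout [] 0 [5, 2])"
      | "order G = 7" "fits ?H (layout [3] 0 [3, 3])"
      | "order G = 8" "fits ?H (layout [3] 0 [2, 3, 3])"
      | "order G = 8" "fits ?H (layout [] 0 [6, 2])"
      | "order G = 9" "fits ?H (layout [3] 0 [3, 3, 3])"
      | "order G = 9" "fits ?H (layout [] 0 [3, 2, 2, 2])"
      using numbered_targets[THEN iff] by (elim disjE conjE) simp_all
    then show "\<exists>c. rainbow_coloring 4 G 3 c"
    proof cases
      case 1
      then show ?thesis by (rule rainbow_coloring_spanning[OF assms(1,2)])
    qed (use colored[OF _ labels_fit(1)] colored[OF _ labels_fit(2)] colored[OF _ labels_fit(3)]
        colored[OF _ labels_fit(4)] colored[OF _ labels_fit(5)] colored[OF _ labels_fit(6)]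
        colored[OF _ labels_fit(7)] colored[OF _ labels_fit(8)] colored[OF _ labels_fit(9)]
        colored[OF _ labels_fit(10)] colored[OF _ labels_fit(11)] colored[OF _ labels_fit(12)]
        rainbow_tables in simp_all)
  qed
qed

end
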